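(* Let $\gamma$ be an even positive integer, $\alpha\in\mathbb{R}$, $-\frac{m}{\gamma}<t<\frac{m}{\gamma}$, and assume $Q+\alpha-2>0$. Then there is a constant $C>0$, independent of $\phi$ and of $r$, such that for every $r>0$ and every $\phi\in C_0^\infty(B_r)$, $$\int_{B_r}\rho^{\alpha}|\nabla_\gamma\rho|^t|\nabla_\gamma\phi|^2\,dz\ \ge\ \Big(\frac{Q+\alpha-2}{2}\Big)^2\int_{B_r}\rho^{\alpha}\frac{|\nabla_\gamma\rho|^{t+2}}{\rho^2}\phi^2\,dz+\frac{1}{C^2r^2}\int_{B_r}\rho^{\alpha}|\nabla_\gamma\rho|^t\phi^2\,dz .$$
   Context: Points of $\mathbb{R}^n$ are written $z=(x,y)$ with $x\in\mathbb{R}^m$, $y\in\mathbb{R}^k$, $m,k\ge1$, $n=m+k$, and $\gamma>0$. The Baouendi–Grushin gradient is $\nabla_\gamma=(\partial_{x_1},\dots,\partial_{x_m},|x|^\gamma\partial_{y_1},\dots,|x|^\gamma\partial_{y_k})$, and the Baouendi–Grushin operator is $\Delta_\gamma=\nabla_\gamma\cdot\nabla_\gamma=\Delta_x+|x|^{2\gamma}\Delta_y$. The homogeneous dimension is $Q=m+(1+\gamma)k$. The gauge is $\rho(z)=\big(|x|^{2(1+\gamma)}+(1+\gamma)^2|y|^2\big)^{\frac{1}{2(1+\gamma)}}$; one has $|\nabla_\gamma\rho|=|x|^\gamma/\rho^\gamma$. For $r>0$, $B_r=\{z\in\mathbb{R}^n:\rho(z)<r\}$. The integral on the left-hand side is allowed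 to be $+\infty$. *)

theory Defs
  imports "HOL-Analysis.Analysis"
begin

fun Ck_fun :: "nat \<Rightarrow> ('a::euclidean_space \<Rightarrow> real) \<Rightarrow> bool" where
  "Ck_fun 0 f = continuous_on UNIV f"
| "Ck_fun (Suc n) f = (f differentiable_on UNIV \<and> continuous_on UNIV f \<and>
      (\<forall>b\<in>Basis. Ck_fun n (\<lambda>z. frechet_derivative f (at z) b)))"

definition smooth_fun :: "('a::euclidean_space \<Rightarrow> real) \<Rightarrow> bool" where
  "smooth_fun f \<longleftrightarrow> (\<forall>n. Ck_fun n f)"

definition test_fun :: "'a::euclidean_space set \<Rightarrow> ('a \<Rightarrow> real) \<Rightarrow> bool" where
  "test_fun U f \<longleftrightarrow> smooth_fun f \<and>
     compact (closure {z. f z \<noteq> 0}) \<and> closure {z. f z \<noteq> 0} \<subseteq> U"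

definition grushin_grad_norm ::
  "nat \<Rightarrow> ((real^'m::finite) \<times> (real^'k::finite) \<Rightarrow> real) \<Rightarrow> (real^'m) \<times> (real^'k) \<Rightarrow> real" where
  "grushin_grad_norm \<gamma> f z =
     sqrt ((\<Sum>b\<in>(Basis::(real^'m) set). (frechet_derivative f (at z) (b, 0))\<^sup>2)
       + (norm (fst z)) ^ (2 * \<gamma>) *
         (\<Sum>b\<in>(Basis::(real^'k) set). (frechet_derivative f (at z) (0, b))\<^sup>2))"

definition gauge :: "nat \<Rightarrow> (real^'m::finite) \<times> (real^'k::finite) \<Rightarrow> real" where
  "gauge \<gamma> z = ((norm (fst z)) ^ (2 * (1 + \<gamma>)) + (1 + real \<gamma>)\<^sup>2 * (norm (snd z))\<^sup>2)
                 powr (1 / (2 * (1 + real \<gamma>)))"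

definition gauge_ball :: "nat \<Rightarrow> real \<Rightarrow> ((real^'m::finite) \<times> (real^'k::finite)) set" where
  "gauge_ball \<gamma> r = {z. gauge \<gamma> z < r}"

definition hom_dim :: "nat \<Rightarrow> nat \<Rightarrow> nat \<Rightarrow> real" where
  "hom_dim m k \<gamma> = real m + (1 + real \<gamma>) * real k"

end

theory Submission
  imports Defs
begin

text \<open>
  Write \<open>\<rho>\<close> for the gauge, \<open>\<psi> = |\<nabla>\<^sub>\<gamma> \<rho>|\<close>, \<open>w = \<rho>\<^sup>\<alpha> \<psi>\<^sup>t\<close> and \<open>c = (Q + \<alpha> - 2) / 2\<close>.
  The function \<open>U = \<rho> powr (- c) * u\<close> with \<open>u = 2 (B + 1) r\<^sup>2 - B \<rho>\<^sup>2 - |x|\<^sup>2\<close> and \<open>2 B = |Q - 2 + t \<gamma>|\<close>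
  is a positive supersolution on \<open>B\<^sub>r\<close>: the term \<open>|x|\<^sup>2\<close> produces the unweighted gain
  \<open>2 (m + t \<gamma>) / u\<close>, which is bounded below by a multiple of \<open>1 / r\<^sup>2\<close>, while the term \<open>B \<rho>\<^sup>2\<close> absorbs
  the error of order \<open>\<psi>\<^sup>2\<close>.  Expanding \<open>|\<nabla>\<^sub>\<gamma> \<phi> - \<phi> \<nabla>\<^sub>\<gamma> U / U|\<^sup>2 \<ge> 0\<close> and integrating by parts gives
  the inequality.  The field \<open>w \<nabla>\<^sub>\<gamma> U / U\<close> is a combination of the generators of the dilations
  \<open>(x, y) \<mapsto> (e\<^sup>\<tau> x, e powr ((1 + \<gamma>) \<tau>) y)\<close> and \<open>(x, y) \<mapsto> (e\<^sup>\<tau> x, y)\<close>, so the integration by parts reduces to the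
  scaling behaviour of Lebesgue measure along these flows; as the flows preserve \<open>x \<noteq> 0\<close>, no regularity
  at the singular set \<open>x = 0\<close> is needed.
\<close>

subsection \<open>Dilation flows\<close>

text \<open>This is the flow of the vector field a x . grad_x + b y . grad_y. Two cases occur later:
  (a, b) = (1, 1 + \<gamma>), the dilations adapted to \<rho>, and (1, 0), which moves x
  alone.\<close>

definition dil :: "real \<Rightarrow> real \<Rightarrow> real \<Rightarrow> 'a::euclidean_space \<times> 'b::euclidean_space \<Rightarrow> 'a \<times> 'b" where
  "dil a b \<tau> z = (exp (a * \<tau>) *\<^sub>R fst z, exp (b * \<tau>) *\<^sub>R snd z)"

lemma fst_dil [simp]: "fst (dil a b \<tau> z) = exp (a * \<tau>) *\<^sub>R fst z"
  and snd_dil [simp]: "snd (dil a b \<tau> z) = exp (b * \<tau>) *\<^sub>R snd z"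
  by (simp_all add: dil_def)

lemma dil_0 [simp]: "dil a b 0 z = z"
  by (simp add: dil_def)

lemma dil_dil: "dil a b \<sigma> (dil a b \<tau> z) = dil a b (\<sigma> + \<tau>) z"
  by (simp add: dil_def exp_add distrib_left)

lemma measurable_dil [measurable]: "dil a b \<tau> \<in> borel_measurable borel"
  unfolding dil_def by (intro borel_measurable_continuous_onI continuous_intros)

lemma measurable_dil_pair: "(\<lambda>p. dil a b (fst p) (snd p)) \<in> borel_measurable borel"
  unfolding dil_def by (intro borel_measurable_continuous_onI continuous_intros)

lemma nn_integral_lborel_scale:
  fixes g :: "'a::euclidean_space \<Rightarrow> ennreal"
  assumes [measurable]: "g \<in> borel_measurable borel" and c: "c > 0"
  shows "(\<integral>\<^sup>+x. g x \<partial>lborel) = ennreal (c ^ DIM('a)) * (\<integral>\<^sup>+x. g (c *\<^sub>R x) \<partial>lborel)"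
  by (subst lborel_affine[of c 0])
     (use c in \<open>simp_all add: nn_integral_density nn_integral_distr nn_integral_cmult\<close>)

lemma nn_integral_lborel_pair:
  fixes f :: "'a::euclidean_space \<times> 'b::euclidean_space \<Rightarrow> ennreal"
  assumes [measurable]: "f \<in> borel_measurable borel"
  shows "(\<integral>\<^sup>+z. f z \<partial>lborel) = (\<integral>\<^sup>+x. \<integral>\<^sup>+y. f (x, y) \<partial>lborel \<partial>lborel)"
  by (subst lborel_prod[symmetric], rule lborel.nn_integral_fst[symmetric]) (simp add: lborel_prod)

text \<open>By Fubini the change of variables is one rescaling in each factor. The exponent is
  \<tau> times the constant divergence of the generator.\<close>

lemma nn_integral_dil:
  fixes f :: "'a::euclidean_space \<times> 'b::euclidean_space \<Rightarrow> ennreal"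
  assumes [measurable]: "f \<in> borel_measurable borel"
  shows "(\<integral>\<^sup>+z. f z \<partial>lborel) =
    ennreal (exp ((a * real DIM('a) + b * real DIM('b)) * \<tau>)) * (\<integral>\<^sup>+z. f (dil a b \<tau> z) \<partial>lborel)"
proof -
  let ?p = "exp (a * \<tau>)" and ?q = "exp (b * \<tau>)"
  have E: "?p ^ DIM('a) * ?q ^ DIM('b) = exp ((a * real DIM('a) + b * real DIM('b)) * \<tau>)"
    unfolding exp_of_nat_mult[symmetric] exp_add[symmetric] by (rule arg_cong[of _ _ exp]) (simp add: algebra_simps)
  have "(\<integral>\<^sup>+z. f z \<partial>lborel) = (\<integral>\<^sup>+x. \<integral>\<^sup>+y. f (x, y) \<partial>lborel \<partial>lborel)"
    by (rule nn_integral_lborel_pair) simp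
  also have "\<dots> = ennreal (?p ^ DIM('a)) * (\<integral>\<^sup>+x. \<integral>\<^sup>+y. f (?p *\<^sub>R x, y) \<partial>lborel \<partial>lborel)"
    by (rule nn_integral_lborel_scale) (simp_all add: borel_prod)
  also have "(\<integral>\<^sup>+x. \<integral>\<^sup>+y. f (?p *\<^sub>R x, y) \<partial>lborel \<partial>lborel)
      = (\<integral>\<^sup>+x. ennreal (?q ^ DIM('b)) * (\<integral>\<^sup>+y. f (?p *\<^sub>R x, ?q *\<^sub>R y) \<partial>lborel) \<partial>lborel)"
    by (intro nn_integral_cong, subst nn_integral_lborel_scale[where c = ?q]) simp_all
  also have "\<dots> = ennreal (?q ^ DIM('b)) * (\<integral>\<^sup>+x. \<integral>\<^sup>+y. f (?p *\<^sub>R x, ?q *\<^sub>R y) \<partial>lborel \<partial>lborel)"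
    by (rule nn_integral_cmult) simp
  also have "(\<integral>\<^sup>+x. \<integral>\<^sup>+y. f (?p *\<^sub>R x, ?q *\<^sub>R y) \<partial>lborel \<partial>lborel) = (\<integral>\<^sup>+z. f (dil a b \<tau> z) \<partial>lborel)"
    by (subst nn_integral_lborel_pair[OF measurable_compose[OF measurable_dil assms]]) (simp add: dil_def)
  also have "ennreal (?p ^ DIM('a)) * (ennreal (?q ^ DIM('b)) * (\<integral>\<^sup>+z. f (dil a b \<tau> z) \<partial>lborel))
      = ennreal (exp ((a * real DIM('a) + b * real DIM('b)) * \<tau>)) * (\<integral>\<^sup>+z. f (dil a b \<tau> z) \<partial>lborel)"
    using E by (simp add: mult.assoc[symmetric] ennreal_mult'[symmetric])
  finally show ?thesis .
qed

lemma
  fixes f :: "'a::euclidean_space \<times> 'b::euclidean_space \<Rightarrow> real"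
  assumes f: "integrable lborel f"
  shows integrable_dil: "integrable lborel (\<lambda>z. f (dil a b \<tau> z))"
    and integral_dil: "(\<integral>z. f (dil a b \<tau> z) \<partial>lborel) =
      exp (- ((a * real DIM('a) + b * real DIM('b)) * \<tau>)) * (\<integral>z. f z \<partial>lborel)"
proof -
  let ?E = "exp ((a * real DIM('a) + b * real DIM('b)) * \<tau>)"
  have [measurable]: "f \<in> borel_measurable borel" using f by auto
  \<comment> \<open>The pushforward of Lebesgue measure is a constant multiple of it, so
    integrability and the value of the integral are both read off from one equality of
    measures.\<close>
  have meq: "distr lborel borel (dil a b \<tau> :: 'a \<times> 'b \<Rightarrow> 'a \<times> 'b) = density lborel (\<lambda>_. ennreal (1 / ?E))"
  proof (rule measure_eqI)
    fix A assume "A \<in> sets (distr lborel borel (dil a b \<tau> :: 'a \<times> 'b \<Rightarrow> _))"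
    then have [measurable]: "A \<in> sets borel" by simp
    have "emeasure (density lborel (\<lambda>_. ennreal (1 / ?E))) A
        = ennreal (1 / ?E) * (\<integral>\<^sup>+z. indicator A z \<partial>lborel)"
      by (simp add: emeasure_density nn_integral_cmult)
    also have "\<dots> = ennreal (1 / ?E) * (ennreal ?E * (\<integral>\<^sup>+z. indicator A (dil a b \<tau> z) \<partial>lborel))"
      by (subst nn_integral_dil[where a = a and b = b and \<tau> = \<tau>]) simp_all
    also have "\<dots> = (\<integral>\<^sup>+z. indicator A (dil a b \<tau> z) \<partial>lborel)"
      by (simp add: mult.assoc[symmetric] ennreal_mult[symmetric])
    also have "\<dots> = emeasure (distr lborel borel (dil a b \<tau>)) A"
      by (subst nn_integral_distr[of "dil a b \<tau>" lborel borel "indicator A", symmetric]) simp_all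
    finally show "emeasure (distr lborel borel (dil a b \<tau>)) A = emeasure (density lborel (\<lambda>_. ennreal (1 / ?E))) A" ..
  qed simp
  have "integrable (density lborel (\<lambda>_. ennreal (1 / ?E))) f"
    by (subst integrable_real_density) (use f in auto)
  then show "integrable lborel (\<lambda>z. f (dil a b \<tau> z))"
    unfolding meq[symmetric] by (subst (asm) integrable_distr_eq) auto
  have "(\<integral>z. f (dil a b \<tau> z) \<partial>lborel) = (\<integral>z. f z \<partial>distr lborel borel (dil a b \<tau>))"
    by (subst integral_distr) auto
  also have "\<dots> = (1 / ?E) * (\<integral>z. f z \<partial>lborel)"
    unfolding meq by (subst integral_real_density) auto
  finally show "(\<integral>z. f (dil a b \<tau> z) \<partial>lborel) =
      exp (- ((a * real DIM('a) + b * real DIM('b)) * \<tau>)) * (\<integral>z. f z \<partial>lborel)"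
    by (simp only: exp_minus inverse_eq_divide)
qed

text \<open>This replaces the divergence theorem for the generator of the flow, whose divergence is
  d. The function h has to be differentiable only along orbits that stay in a set of full measure.
  Integrating h' over space and over times in [0, 1] in both orders gives (1 - exp(-d)) / d times
  the integral of h' and (exp(-d) - 1) times the integral of h.\<close>

lemma integral_flow_derivative:
  fixes h h' :: "'a::euclidean_space \<times> 'b::euclidean_space \<Rightarrow> real"
  assumes h: "integrable lborel h" and h': "integrable lborel h'"
    and d: "d = a * real DIM('a) + b * real DIM('b)" "d > 0"
    and AE: "AE z in lborel. z \<in> G"
    and inv: "\<And>z \<tau>. z \<in> G \<Longrightarrow> dil a b \<tau> z \<in> G"
    and deriv: "\<And>z. z \<in> G \<Longrightarrow> ((\<lambda>\<tau>. h (dil a b \<tau> z)) has_real_derivative h' z) (at 0)"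
  shows "(\<integral>z. h' z \<partial>lborel) = - d * (\<integral>z. h z \<partial>lborel)"
proof -
  have [measurable]: "h' \<in> borel_measurable borel" using h' by auto
  \<comment> \<open>The group law of the flow carries the derivative at time 0 to every
    time.\<close>
  have deriv': "((\<lambda>\<tau>. h (dil a b \<tau> z)) has_real_derivative h' (dil a b \<sigma> z)) (at \<sigma>)" if "z \<in> G" for z \<sigma>
  proof -
    have "((\<lambda>\<tau>. h (dil a b \<tau> (dil a b \<sigma> z))) has_real_derivative h' (dil a b \<sigma> z)) (at (0 + (\<sigma> - \<sigma>)))"
      using deriv[OF inv[OF that, of \<sigma>]] by simp
    then have "((\<lambda>\<tau>. h (dil a b (\<tau> + \<sigma>) z)) has_real_derivative h' (dil a b \<sigma> z)) (at (\<sigma> + - \<sigma>))"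
      by (simp add: dil_dil)
    then have "((\<lambda>\<tau>. h (dil a b (\<tau> + - \<sigma> + \<sigma>) z)) has_real_derivative h' (dil a b \<sigma> z)) (at \<sigma>)"
      by (subst (asm) DERIV_shift)
    then show ?thesis by simp
  qed
  define I where "I = (\<lambda>\<tau>::real. indicator {0..1} \<tau> :: real)"
  define F where "F = (\<lambda>p. I (fst p) * h' (dil a b (fst p) (snd p)))"
  have [measurable]: "(\<lambda>p. h' (dil a b (fst p) (snd p))) \<in> borel_measurable borel"
    using measurable_compose[OF measurable_dil_pair \<open>h' \<in> borel_measurable borel\<close>] by simp
  have [measurable]: "(\<lambda>p. I (fst p)) \<in> borel_measurable (borel :: (real \<times> 'a \<times> 'b) measure)"
    unfolding I_def by (subst borel_prod[symmetric]) measurable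
  have mF: "F \<in> borel_measurable borel" unfolding F_def by measurable
  \<comment> \<open>Fubini applies because the spatial L1 norm of h' after flowing for time \<tau>
    is exp(-d \<tau>) times that of h', hence continuous in \<tau>.\<close>
  have FI: "integrable (lborel \<Otimes>\<^sub>M lborel) F"
  proof (rule lborel_pair.Fubini_integrable)
    show "F \<in> borel_measurable (lborel \<Otimes>\<^sub>M lborel)" using mF by (simp add: lborel_prod)
    show "AE \<tau> in lborel. integrable lborel (\<lambda>z. F (\<tau>, z))"
      unfolding F_def using integrable_dil[OF h'] by auto
    have eq: "(\<lambda>\<tau>. \<integral>z. norm (F (\<tau>, z)) \<partial>lborel)
        = (\<lambda>\<tau>. indicator {0..1} \<tau> *\<^sub>R (exp (- (d * \<tau>)) * (\<integral>z. \<bar>h' z\<bar> \<partial>lborel)))"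
      using integral_dil[OF integrable_abs[OF h']] unfolding F_def I_def
      by (auto simp: abs_mult d(1) indicator_def)
    show "integrable lborel (\<lambda>\<tau>. \<integral>z. norm (F (\<tau>, z)) \<partial>lborel)"
      unfolding eq
      by (rule borel_integrable_atLeastAtMost'[unfolded set_integrable_def]) (intro continuous_intros)
  qed
  have "(\<integral>\<tau>. \<integral>z. F (\<tau>, z) \<partial>lborel \<partial>lborel) = (\<integral>z. \<integral>\<tau>. F (\<tau>, z) \<partial>lborel \<partial>lborel)"
    using lborel_pair.Fubini_integral[of "\<lambda>\<tau> z. F (\<tau>, z)"] FI by (simp add: case_prod_unfold)
  \<comment> \<open>Time first: on almost every orbit the fundamental theorem of calculus gives the
    increment of h from time 0 to time 1.\<close>
  moreover have "(\<integral>z. \<integral>\<tau>. F (\<tau>, z) \<partial>lborel \<partial>lborel) = (\<integral>z. h (dil a b 1 z) - h z \<partial>lborel)"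
  proof (rule integral_cong_AE)
    show "(\<lambda>z. \<integral>\<tau>. F (\<tau>, z) \<partial>lborel) \<in> borel_measurable lborel"
      using lborel_pair.integrable_snd[of "\<lambda>\<tau> z. F (\<tau>, z)"] FI
      by (intro borel_measurable_integrable) (simp add: case_prod_unfold)
    show "(\<lambda>z. h (dil a b 1 z) - h z) \<in> borel_measurable lborel"
      using integrable_dil[OF h, of a b 1] h by (intro borel_measurable_diff borel_measurable_integrable)
    have "AE z in lborel. integrable lborel (\<lambda>\<tau>. F (\<tau>, z))"
      using lborel_pair.AE_integrable_snd[of "\<lambda>\<tau> z. F (\<tau>, z)"] FI by (simp add: case_prod_unfold)
    then show "AE z in lborel. (\<integral>\<tau>. F (\<tau>, z) \<partial>lborel) = h (dil a b 1 z) - h z"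
      using AE
    proof eventually_elim
      case (elim z)
      have "((\<lambda>\<tau>. h' (dil a b \<tau> z)) has_integral h (dil a b 1 z) - h (dil a b 0 z)) {0..1}"
        by (rule fundamental_theorem_of_calculus)
           (auto intro!: deriv'[OF elim(2)] has_field_derivative_at_within
              simp: has_real_derivative_iff_has_vector_derivative[symmetric])
      moreover have si: "set_integrable lborel {0..1} (\<lambda>\<tau>. h' (dil a b \<tau> z))"
        using elim(1) unfolding F_def I_def set_integrable_def by simp
      ultimately have "h (dil a b 1 z) - h z = (LINT \<tau>:{0..1}|lborel. h' (dil a b \<tau> z))"
        using set_borel_integral_eq_integral[OF si] by (simp add: integral_unique)
      then show ?case by (simp add: F_def I_def set_lebesgue_integral_def)
    qed
  qed
  moreover have "(\<integral>z. h (dil a b 1 z) - h z \<partial>lborel) = (exp (- d) - 1) * (\<integral>z. h z \<partial>lborel)"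
    using integral_dil[OF h, of a b 1] integrable_dil[OF h, of a b 1] h d(1)
    by (simp add: algebra_simps)
  \<comment> \<open>Space first: each time slice contributes exp(-d \<tau>) times the integral of
    h'.\<close>
  moreover have "(\<integral>\<tau>. \<integral>z. F (\<tau>, z) \<partial>lborel \<partial>lborel) = (1 - exp (- d)) / d * (\<integral>z. h' z \<partial>lborel)"
  proof -
    have "(\<integral>\<tau>. \<integral>z. F (\<tau>, z) \<partial>lborel \<partial>lborel)
       = (\<integral>\<tau>. (indicator {0..1} \<tau> *\<^sub>R exp (- (d * \<tau>))) * (\<integral>z. h' z \<partial>lborel) \<partial>lborel)"
      using integral_dil[OF h', of a b] d(1) by (simp add: F_def I_def mult.assoc)
    also have "\<dots> = (\<integral>\<tau>. indicator {0..1} \<tau> *\<^sub>R exp (- (d * \<tau>)) \<partial>lborel) * (\<integral>z. h' z \<partial>lborel)"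
      by simp
    also have "(\<integral>\<tau>. indicator {0..1} \<tau> *\<^sub>R exp (- (d * \<tau>)) \<partial>lborel)
       = (- exp (- (d * 1)) / d) - (- exp (- (d * 0)) / d)"
    proof (rule integral_FTC_atLeastAtMost[where F = "\<lambda>\<tau>. - exp (- (d * \<tau>)) / d"])
      fix \<tau> :: real
      have "((\<lambda>\<tau>. - exp (- (d * \<tau>)) / d) has_real_derivative exp (- (d * \<tau>))) (at \<tau> within {0..1})"
        using d(2) by (auto intro!: derivative_eq_intros)
      then show "((\<lambda>\<tau>. - exp (- (d * \<tau>)) / d) has_vector_derivative exp (- (d * \<tau>))) (at \<tau> within {0..1})"
        by (simp add: has_real_derivative_iff_has_vector_derivative)
    qed (auto intro!: continuous_intros)
    finally show ?thesis by (simp add: diff_divide_distrib)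
  qed
  ultimately have "(1 - exp (- d)) / d * (\<integral>z. h' z \<partial>lborel) = (exp (- d) - 1) * (\<integral>z. h z \<partial>lborel)"
    by simp
  then have "d * ((1 - exp (- d)) / d * (\<integral>z. h' z \<partial>lborel)) = d * ((exp (- d) - 1) * (\<integral>z. h z \<partial>lborel))"
    by (rule arg_cong)
  then have "(1 - exp (- d)) * (\<integral>z. h' z \<partial>lborel) = d * ((exp (- d) - 1) * (\<integral>z. h z \<partial>lborel))"
    using d(2) by simp
  then have "(1 - exp (- d)) * ((\<integral>z. h' z \<partial>lborel) + d * (\<integral>z. h z \<partial>lborel)) = 0"
    by algebra
  then show ?thesis using d(2) by auto
qed

subsection \<open>Integrability of the weights\<close>

text \<open>The region 0 < N < R splits into shells on which N shrinks by a factor e. The dilation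
  for time -j maps shell 0 onto shell j, so the integrals form a geometric series with ratio exp(-(p
  + d)), which converges because p + d > 0.\<close>

lemma nn_integral_homogeneous_finite:
  fixes f N :: "'a::euclidean_space \<times> 'b::euclidean_space \<Rightarrow> real"
  assumes [measurable]: "f \<in> borel_measurable borel" "N \<in> borel_measurable borel"
    and f0: "\<And>z. f z \<ge> 0" and R: "R > 0"
    and fhom: "\<And>\<tau> z. f (dil a b \<tau> z) = exp (p * \<tau>) * f z"
    and Nhom: "\<And>\<tau> z. N (dil a b \<tau> z) = exp \<tau> * N z"
    and pd: "p + (a * real DIM('a) + b * real DIM('b)) > 0"
    and fin: "(\<integral>\<^sup>+z. ennreal (f z) * indicator {z. R * exp (- 1) \<le> N z \<and> N z < R} z \<partial>lborel) < \<infinity>"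
  shows "(\<integral>\<^sup>+z. ennreal (f z) * indicator {z. 0 < N z \<and> N z < R} z \<partial>lborel) < \<infinity>"
proof -
  define d where "d = a * real DIM('a) + b * real DIM('b)"
  define S where "S = (\<lambda>j::nat. {z. R * exp (- (real j + 1)) \<le> N z \<and> N z < R * exp (- real j)})"
  have [measurable]: "S j \<in> sets borel" for j unfolding S_def by measurable
  define J where "J = (\<integral>\<^sup>+z. ennreal (f z) * indicator (S 0) z \<partial>lborel)"
  have J: "J < \<infinity>" using fin by (simp add: J_def S_def)
  have shell: "(\<integral>\<^sup>+z. ennreal (f z) * indicator (S j) z \<partial>lborel) = J * ennreal (exp (- (p + d)) ^ j)" for j
  proof -
    have ind: "indicator (S j) (dil a b (- real j) z) = (indicator (S 0) z :: ennreal)" for z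
    proof -
      have "R * exp (- (real j + 1)) \<le> exp (- real j) * N z \<longleftrightarrow> R * exp (- 1) \<le> N z"
        by (simp add: exp_diff exp_minus field_simps)
      moreover have "exp (- real j) * N z < R * exp (- real j) \<longleftrightarrow> N z < R"
        by (simp add: exp_minus field_simps)
      ultimately show ?thesis by (simp add: S_def indicator_def Nhom)
    qed
    have "(\<integral>\<^sup>+z. ennreal (f z) * indicator (S j) z \<partial>lborel)
        = ennreal (exp (d * - real j)) * (\<integral>\<^sup>+z. ennreal (exp (p * - real j)) * (ennreal (f z) * indicator (S 0) z) \<partial>lborel)"
      by (subst nn_integral_dil[where a = a and b = b and \<tau> = "- real j"])
         (simp_all add: d_def fhom ind ennreal_mult f0 mult_ac)
    also have "\<dots> = ennreal (exp (d * - real j)) * (ennreal (exp (p * - real j)) * J)"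
      by (simp add: nn_integral_cmult J_def)
    also have "\<dots> = J * ennreal (exp (- (p + d)) ^ j)"
    proof -
      have "exp (d * - real j) * exp (p * - real j) = exp (- (p + d)) ^ j"
        unfolding exp_of_nat_mult[symmetric] exp_add[symmetric]
        by (rule arg_cong[of _ _ exp]) (simp add: algebra_simps)
      then show ?thesis
        by (subst mult.assoc[symmetric], subst ennreal_mult[symmetric]) (simp_all add: mult.commute)
    qed
    finally show ?thesis .
  qed
  have "(\<integral>\<^sup>+z. ennreal (f z) * indicator {z. 0 < N z \<and> N z < R} z \<partial>lborel)
      \<le> (\<integral>\<^sup>+z. (\<Sum>j. ennreal (f z) * indicator (S j) z) \<partial>lborel)"
  proof (rule nn_integral_mono)
    fix z
    show "ennreal (f z) * indicator {z. 0 < N z \<and> N z < R} z \<le> (\<Sum>j. ennreal (f z) * indicator (S j) z)"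
    proof (cases "0 < N z \<and> N z < R")
      case True
      have L: "ln (R / N z) > 0" using True by simp
      \<comment> \<open>The shells contain their inner boundary and not their outer one, so j must
        satisfy j < ln (R / N z) \<le> j + 1. This calls for the ceiling minus 1 and not for the
        floor.\<close>
      obtain j :: nat where j: "real j < ln (R / N z)" "ln (R / N z) \<le> real j + 1"
      proof
        have "real (nat (\<lceil>ln (R / N z)\<rceil> - 1)) = real_of_int (\<lceil>ln (R / N z)\<rceil> - 1)"
          using L by (subst of_nat_nat) auto
        then show "real (nat (\<lceil>ln (R / N z)\<rceil> - 1)) < ln (R / N z)"
          "ln (R / N z) \<le> real (nat (\<lceil>ln (R / N z)\<rceil> - 1)) + 1"
          by linarith+
      qed
      have "N z < R * exp (- real j)"
      proof -
        have "exp (real j) < R / N z"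
          using exp_less_mono[OF j(1)] True R by (simp only: exp_ln divide_pos_pos)
        then show ?thesis using True by (simp add: exp_minus field_simps)
      qed
      moreover have "R * exp (- (real j + 1)) \<le> N z"
      proof -
        have "exp (ln (R / N z)) \<le> exp (real j + 1)" using j(2) by (simp only: exp_le_cancel_iff)
        then have "R / N z \<le> exp (real j + 1)" using True R by (simp only: exp_ln divide_pos_pos)
        then show ?thesis using True unfolding exp_minus by (simp add: field_simps)
      qed
      ultimately have "z \<in> S j" by (simp add: S_def)
      then have "ennreal (f z) * indicator {z. 0 < N z \<and> N z < R} z = (\<Sum>i\<in>{j}. ennreal (f z) * indicator (S i) z)"
        using True by simp
      also have "\<dots> \<le> (\<Sum>i. ennreal (f z) * indicator (S i) z)"
        by (rule sum_le_suminf) auto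
      finally show ?thesis .
    qed simp
  qed
  also have "\<dots> = (\<Sum>j. \<integral>\<^sup>+z. ennreal (f z) * indicator (S j) z \<partial>lborel)"
    by (rule nn_integral_suminf) measurable
  also have "\<dots> = J * (\<Sum>j. ennreal (exp (- (p + d)) ^ j))"
    unfolding shell by (rule ennreal_suminf_cmult)
  also have "\<dots> < \<infinity>"
  proof -
    have "summable (\<lambda>j. exp (- (p + d)) ^ j)"
      using pd by (intro summable_geometric) (simp add: d_def)
    then show ?thesis
      using J by (subst suminf_ennreal2) (auto simp: ennreal_mult_eq_top_iff less_top[symmetric])
  qed
  finally show ?thesis .
qed

text \<open>The power is monotone in its base, in a direction given by the sign of p. The sum of the
  two endpoint values bounds it for either sign.\<close>

lemma powr_le_sum:
  fixes x :: real
  assumes "0 < l" "l \<le> x" "x \<le> u"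
  shows "x powr p \<le> l powr p + u powr p"
proof (cases "p \<ge> 0")
  case True
  then have "x powr p \<le> u powr p" using assms by (intro powr_mono2) auto
  then show ?thesis by (simp add: add_increasing)
next
  case False
  then have "x powr p \<le> l powr p" using assms by (intro powr_mono2') auto
  then show ?thesis by (simp add: add_increasing2)
qed

section \<open>The gauge: comparison with the coordinates, continuity, homogeneity\<close>

lemma gauge_nonneg: "gauge \<gamma> z \<ge> 0"
  by (simp add: gauge_def)

lemma gauge_pow: "gauge \<gamma> z ^ (2 * (1 + \<gamma>)) = norm (fst z) ^ (2 * (1 + \<gamma>)) + (1 + real \<gamma>)\<^sup>2 * (norm (snd z))\<^sup>2"
proof -
  define P where "P = norm (fst z) ^ (2 * (1 + \<gamma>)) + (1 + real \<gamma>)\<^sup>2 * (norm (snd z))\<^sup>2"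
  have P: "P \<ge> 0" by (simp add: P_def)
  have g: "gauge \<gamma> z = P powr (1 / (2 * (1 + real \<gamma>)))" by (simp only: gauge_def P_def)
  have "gauge \<gamma> z ^ (2 * (1 + \<gamma>)) = P"
  \<comment> \<open>Turning a natural power into \<open>powr\<close> requires a positive base; at P
    = 0 both sides vanish.\<close>
  proof (cases "P = 0")
    case True
    then show ?thesis by (simp add: g)
  next
    case False
    then have "P > 0" using P by simp
    then show ?thesis
      by (simp add: g powr_realpow[symmetric] powr_powr del: mult_Suc_right power_Suc)
  qed
  then show ?thesis by (simp add: P_def)
qed

lemma norm_fst_le_gauge: "norm (fst z) \<le> gauge \<gamma> z"
proof (rule power_le_imp_le_base)
  show "norm (fst z) ^ Suc (2 * \<gamma> + 1) \<le> gauge \<gamma> z ^ Suc (2 * \<gamma> + 1)"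
    using gauge_pow[of \<gamma> z] by simp
qed (rule gauge_nonneg)

lemma norm_snd_le_gauge: "norm (snd z) \<le> gauge \<gamma> z ^ (1 + \<gamma>)"
proof (rule power2_le_imp_le)
  have "(norm (snd z))\<^sup>2 * 1 \<le> (norm (snd z))\<^sup>2 * (1 + real \<gamma>)\<^sup>2"
    by (intro mult_left_mono) auto
  also have "\<dots> \<le> gauge \<gamma> z ^ (2 * (1 + \<gamma>))"
    by (simp only: gauge_pow) (simp add: mult.commute)
  also have "\<dots> = (gauge \<gamma> z ^ (1 + \<gamma>))\<^sup>2"
    by (metis mult.commute power_mult)
  finally show "(norm (snd z))\<^sup>2 \<le> (gauge \<gamma> z ^ (1 + \<gamma>))\<^sup>2"
    by (simp only: mult_1_right)
qed (simp add: gauge_nonneg)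

lemma gauge_pos: "fst z \<noteq> 0 \<Longrightarrow> gauge \<gamma> z > 0"
  using norm_fst_le_gauge[of z \<gamma>] by (meson order_less_le_trans zero_less_norm_iff)

lemma continuous_on_gauge: "continuous_on UNIV (gauge \<gamma>)"
  unfolding gauge_def
  by (intro continuous_intros continuous_on_powr') auto

lemma measurable_gauge [measurable]: "gauge \<gamma> \<in> borel_measurable borel"
  using continuous_on_gauge by (rule borel_measurable_continuous_onI)

lemma open_gauge_ball: "open (gauge_ball \<gamma> r)"
  unfolding gauge_ball_def by (intro open_Collect_less continuous_on_gauge continuous_on_const)

lemma gauge_dil: "gauge \<gamma> (dil 1 (1 + real \<gamma>) \<tau> z) = exp \<tau> * gauge \<gamma> z"
proof (rule power_eq_imp_eq_base)
  have "(exp ((1 + real \<gamma>) * \<tau>))\<^sup>2 = exp \<tau> ^ (2 * (1 + \<gamma>))"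
    unfolding exp_of_nat_mult[symmetric] by (rule arg_cong[of _ _ exp]) (simp add: algebra_simps)
  then show "gauge \<gamma> (dil 1 (1 + real \<gamma>) \<tau> z) ^ (2 * (1 + \<gamma>)) = (exp \<tau> * gauge \<gamma> z) ^ (2 * (1 + \<gamma>))"
    by (simp only: power_mult_distrib gauge_pow fst_dil snd_dil norm_scaleR) (simp add: power_mult_distrib algebra_simps)
qed (auto simp: gauge_nonneg)

text \<open>The weight \<open>\<rho> powr \<beta> * |\<nabla>\<^sub>\<gamma> \<rho>| powr t\<close> of the theorem has \<open>\<eta> = \<gamma> t\<close>.\<close>

definition wt :: "nat \<Rightarrow> real \<Rightarrow> real \<Rightarrow> (real^'m::finite) \<times> (real^'k::finite) \<Rightarrow> real" where
  "wt \<gamma> \<beta> \<eta> z = gauge \<gamma> z powr \<beta> * (norm (fst z) / gauge \<gamma> z) powr \<eta>"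

lemma wt_nonneg: "wt \<gamma> \<beta> \<eta> z \<ge> 0"
  by (simp add: wt_def)

lemma wt_dil: "wt \<gamma> \<beta> \<eta> (dil 1 (1 + real \<gamma>) \<tau> z) = exp (\<beta> * \<tau>) * wt \<gamma> \<beta> \<eta> z"
  by (simp add: wt_def gauge_dil powr_mult gauge_nonneg exp_powr_real mult.commute)

lemma measurable_wt [measurable]: "wt \<gamma> \<beta> \<eta> \<in> borel_measurable borel"
  unfolding wt_def by (intro borel_measurable_times powr_real_measurable borel_measurable_divide
      measurable_gauge borel_measurable_const borel_measurable_continuous_onI continuous_intros)

text \<open>The homogeneity argument is used twice. In x alone it makes the power \<eta> of |x|
  integrable on a cylinder, since m + \<eta> > 0. On a shell of the gauge the weight is at most a
  constant times that power, so the dilations adapted to \<rho>, under which the weight has degree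
  \<beta>, finish the proof since Q + \<beta> > 0.\<close>

lemma nn_integral_wt_gauge_ball:
  assumes \<beta>: "hom_dim CARD('m) CARD('k) \<gamma> + \<beta> > 0" and \<eta>: "real CARD('m) + \<eta> > 0" and R: "R > 0"
  shows "(\<integral>\<^sup>+z. ennreal (wt \<gamma> \<beta> \<eta> (z :: (real^'m::finite) \<times> (real^'k::finite))) *
            indicator (gauge_ball \<gamma> R) z \<partial>lborel) < \<infinity>"
proof -
  \<comment> \<open>On the gauge ball of radius R this bounds |y|, so the part of the ball with x
    \<noteq> 0 lies in the cylinder that carries \<open>g\<close>.\<close>
  define Y where "Y = R ^ (1 + \<gamma>)"
  define g where "g = (\<lambda>z :: (real^'m) \<times> (real^'k). norm (fst z) powr \<eta> * indicator {z. norm (snd z) \<le> Y} z)"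
  have [measurable]: "(\<lambda>z :: (real^'m) \<times> (real^'k). norm (fst z)) \<in> borel_measurable borel"
    by (intro borel_measurable_continuous_onI continuous_intros)
  have [measurable]: "(\<lambda>z :: (real^'m) \<times> (real^'k). norm (snd z)) \<in> borel_measurable borel"
    by (intro borel_measurable_continuous_onI continuous_intros)
  have [measurable]: "g \<in> borel_measurable borel" unfolding g_def by measurable
  have g0: "g z \<ge> 0" for z by (simp add: g_def)
  have gfin: "(\<integral>\<^sup>+z. ennreal (g z) * indicator {z. 0 < norm (fst z) \<and> norm (fst z) < R} z \<partial>lborel) < \<infinity>"
  proof (rule nn_integral_homogeneous_finite[where a = 1 and b = 0 and p = \<eta>])
    show "g (dil 1 0 \<tau> z) = exp (\<eta> * \<tau>) * g z" for \<tau> z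
      by (simp add: g_def powr_mult exp_powr_real indicator_def mult.commute)
    let ?c = "(R * exp (-1)) powr \<eta> + R powr \<eta>"
    have "(\<integral>\<^sup>+z. ennreal (g z) * indicator {z. R * exp (- 1) \<le> norm (fst z) \<and> norm (fst z) < R} z \<partial>lborel)
        \<le> (\<integral>\<^sup>+z. ennreal ?c * indicator (cball 0 R \<times> cball 0 Y) (z :: (real^'m) \<times> (real^'k)) \<partial>lborel)"
    proof (rule nn_integral_mono)
      fix z :: "(real^'m) \<times> (real^'k)"
      show "ennreal (g z) * indicator {z. R * exp (- 1) \<le> norm (fst z) \<and> norm (fst z) < R} z
          \<le> ennreal ?c * indicator (cball 0 R \<times> cball 0 Y) z"
        using powr_le_sum[of "R * exp (-1)" "norm (fst z)" R \<eta>] R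
        by (cases z) (auto simp: g_def indicator_def simp del: ennreal_plus intro!: ennreal_leI)
    qed
    also have "\<dots> = ennreal ?c * emeasure lborel (cball (0 :: real^'m) R \<times> cball (0 :: real^'k) Y)"
      by (intro nn_integral_cmult_indicator) (simp add: borel_Times)
    also have "\<dots> < \<infinity>"
      using emeasure_bounded_finite[OF bounded_Times[OF bounded_cball bounded_cball], of "0 :: real^'m" R "0 :: real^'k" Y]
      by (simp add: ennreal_mult_less_top)
    finally show "(\<integral>\<^sup>+z. ennreal (g z) * indicator {z. R * exp (- 1) \<le> norm (fst z) \<and> norm (fst z) < R} z \<partial>lborel) < \<infinity>" .
  qed (use R \<eta> g0 in \<open>auto\<close>)
  have "(\<integral>\<^sup>+z. ennreal (wt \<gamma> \<beta> \<eta> z) * indicator {z. 0 < gauge \<gamma> z \<and> gauge \<gamma> z < R}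
       (z :: (real^'m) \<times> (real^'k)) \<partial>lborel) < \<infinity>"
  proof (rule nn_integral_homogeneous_finite[where a = 1 and b = "1 + real \<gamma>" and p = \<beta>])
    show "wt \<gamma> \<beta> \<eta> (dil 1 (1 + real \<gamma>) \<tau> z) = exp (\<beta> * \<tau>) * wt \<gamma> \<beta> \<eta> z" for \<tau> and z :: "(real^'m) \<times> (real^'k)"
      by (rule wt_dil)
    show "gauge \<gamma> (dil 1 (1 + real \<gamma>) \<tau> z) = exp \<tau> * gauge \<gamma> z" for \<tau> and z :: "(real^'m) \<times> (real^'k)"
      by (rule gauge_dil)
    show "\<beta> + (1 * real DIM(real^'m) + (1 + real \<gamma>) * real DIM(real^'k)) > 0"
      using \<beta> by (simp add: hom_dim_def)
    let ?c = "(R * exp (-1)) powr (\<beta> - \<eta>) + R powr (\<beta> - \<eta>)"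
    have "(\<integral>\<^sup>+z. ennreal (wt \<gamma> \<beta> \<eta> z) * indicator {z. R * exp (- 1) \<le> gauge \<gamma> z \<and> gauge \<gamma> z < R}
            (z :: (real^'m) \<times> (real^'k)) \<partial>lborel)
        \<le> (\<integral>\<^sup>+z. ennreal ?c * (ennreal (g z) * indicator {z. 0 < norm (fst z) \<and> norm (fst z) < R} z) \<partial>lborel)"
    proof (rule nn_integral_mono)
      fix z :: "(real^'m) \<times> (real^'k)"
      show "ennreal (wt \<gamma> \<beta> \<eta> z) * indicator {z. R * exp (- 1) \<le> gauge \<gamma> z \<and> gauge \<gamma> z < R} z
          \<le> ennreal ?c * (ennreal (g z) * indicator {z. 0 < norm (fst z) \<and> norm (fst z) < R} z)"
      proof (cases "R * exp (- 1) \<le> gauge \<gamma> z \<and> gauge \<gamma> z < R \<and> fst z \<noteq> 0")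
        case True
        then have pos: "gauge \<gamma> z > 0" "norm (fst z) > 0" using gauge_pos[of z \<gamma>] by auto
        have "norm (snd z) \<le> Y"
          unfolding Y_def
          by (rule order_trans[OF norm_snd_le_gauge power_mono]) (use True pos in \<open>simp_all\<close>)
        moreover have "norm (fst z) < R" using norm_fst_le_gauge[of z \<gamma>] True by linarith
        \<comment> \<open>This separates the factor that may be singular at x = 0 from a power of
          \<rho>, which is bounded on the shell.\<close>
        moreover have "wt \<gamma> \<beta> \<eta> z = gauge \<gamma> z powr (\<beta> - \<eta>) * norm (fst z) powr \<eta>"
          using pos by (simp add: wt_def powr_divide powr_diff)
        moreover have "gauge \<gamma> z powr (\<beta> - \<eta>) \<le> ?c"
          using True R by (intro powr_le_sum) auto
        ultimately show ?thesis
          using pos True by (simp add: g_def ennreal_mult[symmetric] mult_right_mono ennreal_leI del: ennreal_plus)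
      next
        case False
        then show ?thesis by (auto simp: indicator_def wt_def)
      qed
    qed
    also have "\<dots> = ennreal ?c * (\<integral>\<^sup>+z. ennreal (g z) * indicator {z. 0 < norm (fst z) \<and> norm (fst z) < R} z \<partial>lborel)"
      by (rule nn_integral_cmult) measurable
    also have "\<dots> < \<infinity>" using gfin by (simp add: ennreal_mult_less_top)
    finally show "(\<integral>\<^sup>+z. ennreal (wt \<gamma> \<beta> \<eta> z) * indicator {z. R * exp (- 1) \<le> gauge \<gamma> z \<and> gauge \<gamma> z < R}
            (z :: (real^'m) \<times> (real^'k)) \<partial>lborel) < \<infinity>" .
  qed (use R wt_nonneg in auto)
  \<comment> \<open>The point with \<rho> = 0 may be added to the region, because
    \<open>powr\<close> with base 0 is 0 and the weight vanishes there.\<close>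
  also have "(\<lambda>z :: (real^'m) \<times> (real^'k). ennreal (wt \<gamma> \<beta> \<eta> z) * indicator {z. 0 < gauge \<gamma> z \<and> gauge \<gamma> z < R} z)
      = (\<lambda>z. ennreal (wt \<gamma> \<beta> \<eta> z) * indicator (gauge_ball \<gamma> R) z)"
    by (rule ext) (auto simp: gauge_ball_def indicator_def wt_def less_le gauge_nonneg)
  finally show ?thesis .
qed

lemma integrable_wt_mult:
  fixes k :: "(real^'m::finite) \<times> (real^'k::finite) \<Rightarrow> real"
  assumes \<beta>: "hom_dim CARD('m) CARD('k) \<gamma> + \<beta> > 0" and \<eta>: "real CARD('m) + \<eta> > 0" and R: "R > 0"
    and [measurable]: "k \<in> borel_measurable borel"
    and zero: "\<And>z. z \<notin> gauge_ball \<gamma> R \<Longrightarrow> k z = 0"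
    and bd: "\<And>z. z \<in> gauge_ball \<gamma> R \<Longrightarrow> fst z \<noteq> 0 \<Longrightarrow> \<bar>k z\<bar> \<le> M"
  shows "integrable lborel (\<lambda>z. wt \<gamma> \<beta> \<eta> z * k z)"
proof (rule integrableI_bounded)
  have "(\<integral>\<^sup>+z. ennreal (norm (wt \<gamma> \<beta> \<eta> z * k z)) \<partial>lborel)
      \<le> (\<integral>\<^sup>+z. ennreal \<bar>M\<bar> * (ennreal (wt \<gamma> \<beta> \<eta> z) * indicator (gauge_ball \<gamma> R) (z :: (real^'m) \<times> (real^'k))) \<partial>lborel)"
  proof (rule nn_integral_mono)
    fix z :: "(real^'m) \<times> (real^'k)"
    show "ennreal (norm (wt \<gamma> \<beta> \<eta> z * k z)) \<le> ennreal \<bar>M\<bar> * (ennreal (wt \<gamma> \<beta> \<eta> z) * indicator (gauge_ball \<gamma> R) z)"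
    proof (cases "z \<in> gauge_ball \<gamma> R \<and> fst z \<noteq> 0")
      case True
      then have "norm (wt \<gamma> \<beta> \<eta> z * k z) \<le> \<bar>M\<bar> * wt \<gamma> \<beta> \<eta> z"
        using bd[of z] wt_nonneg[of \<gamma> \<beta> \<eta> z] by (simp add: abs_mult mult.commute mult_right_mono order_trans[OF _ abs_ge_self])
      then show ?thesis using True wt_nonneg[of \<gamma> \<beta> \<eta> z] by (simp add: ennreal_mult[symmetric] ennreal_leI)
    next
      \<comment> \<open>At x = 0 the second factor of the weight is a power of 0, which is 0 for
        every exponent, so a bound on k is asked for only where x \<noteq> 0.\<close>
      case False
      then show ?thesis using zero[of z] by (auto simp: wt_def)
    qed
  qed
  also have "\<dots> = ennreal \<bar>M\<bar> * (\<integral>\<^sup>+z. ennreal (wt \<gamma> \<beta> \<eta> (z :: (real^'m) \<times> (real^'k))) * indicator (gauge_ball \<gamma> R) z \<partial>lborel)"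
    by (rule nn_integral_cmult) (simp add: borel_open open_gauge_ball)
  also have "\<dots> < \<infinity>"
    using nn_integral_wt_gauge_ball[OF \<beta> \<eta> R] by (simp add: ennreal_mult_less_top)
  finally show "(\<integral>\<^sup>+z. ennreal (norm (wt \<gamma> \<beta> \<eta> z * k z)) \<partial>lborel) < \<infinity>" .
qed simp

subsection \<open>Derivatives along the dilation flows\<close>

text \<open>Since m \<ge> 1, the set x = 0 lies in a coordinate hyperplane.\<close>

lemma AE_fst_nonzero: "AE z in lborel. fst (z :: (real^'m::finite) \<times> (real^'k::finite)) \<noteq> 0"
proof -
  obtain i :: "real^'m" where i: "i \<in> Basis" using nonempty_Basis by blast
  let ?S = "{z :: (real^'m) \<times> (real^'k). z \<bullet> (i, 0) = 0}"
  have "(i, 0 :: real^'k) \<in> Basis" using i by (simp add: Basis_prod_def)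
  then have "negligible ?S" by (rule negligible_standard_hyperplane)
  moreover have "?S \<in> sets borel"
    by (intro borel_closed closed_Collect_eq continuous_intros)
  ultimately have "?S \<in> null_sets lborel"
    by (simp add: negligible_iff_null_sets null_sets_completion_iff)
  then have "AE z in lborel. z \<notin> ?S" by (rule AE_not_in)
  then show ?thesis by (rule AE_mp) (auto simp: inner_prod_def)
qed

text \<open>Collecting the partial derivatives into vectors turns the coordinate sums of
  \<open>grushin_grad_norm\<close> into norms, and derivatives along the flows into inner products
  with x and y.\<close>

definition grad_fst :: "((real^'m::finite) \<times> (real^'k::finite) \<Rightarrow> real) \<Rightarrow> (real^'m) \<times> (real^'k) \<Rightarrow> real^'m" where
  "grad_fst f z = (\<Sum>b\<in>Basis. frechet_derivative f (at z) (b, 0) *\<^sub>R b)"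

definition grad_snd :: "((real^'m::finite) \<times> (real^'k::finite) \<Rightarrow> real) \<Rightarrow> (real^'m) \<times> (real^'k) \<Rightarrow> real^'k" where
  "grad_snd f z = (\<Sum>b\<in>Basis. frechet_derivative f (at z) (0, b) *\<^sub>R b)"

lemma frechet_derivative_eq_grad:
  assumes "f differentiable (at z)"
  shows "frechet_derivative f (at z) v = grad_fst f z \<bullet> fst v + grad_snd f z \<bullet> snd v"
proof -
  let ?D = "frechet_derivative f (at z)"
  have lin: "linear ?D" using assms linear_frechet_derivative by blast
  have "v = (\<Sum>b\<in>Basis. (fst v \<bullet> b) *\<^sub>R (b, 0)) + (\<Sum>b\<in>Basis. (snd v \<bullet> b) *\<^sub>R (0, b))"
    by (simp add: prod_eq_iff fst_sum snd_sum euclidean_representation)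
  then have "?D v = ?D ((\<Sum>b\<in>Basis. (fst v \<bullet> b) *\<^sub>R (b, 0)) + (\<Sum>b\<in>Basis. (snd v \<bullet> b) *\<^sub>R (0, b)))"
    by simp
  also have "\<dots> = (\<Sum>b\<in>Basis. (fst v \<bullet> b) * ?D (b, 0)) + (\<Sum>b\<in>Basis. (snd v \<bullet> b) * ?D (0, b))"
    by (simp only: linear_add[OF lin] linear_sum[OF lin] linear_scale[OF lin] real_scaleR_def)
  also have "(\<Sum>b\<in>Basis. (fst v \<bullet> b) * ?D (b, 0)) = fst v \<bullet> grad_fst f z"
    by (simp add: grad_fst_def inner_sum_right mult.commute)
  also have "(\<Sum>b\<in>Basis. (snd v \<bullet> b) * ?D (0, b)) = snd v \<bullet> grad_snd f z"
    by (simp add: grad_snd_def inner_sum_right mult.commute)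
  finally show ?thesis by (simp only: inner_commute)
qed

lemma norm_sum_Basis: "(norm (\<Sum>b\<in>Basis. g b *\<^sub>R b))\<^sup>2 = (\<Sum>b\<in>Basis. (g b)\<^sup>2)"
  unfolding power2_norm_eq_inner by (subst euclidean_inner) (simp add: power2_eq_square)

lemma sum_Basis_inner_sq: "(\<Sum>b\<in>Basis. (c * (v \<bullet> b))\<^sup>2) = c\<^sup>2 * (norm v)\<^sup>2"
  unfolding power2_norm_eq_inner power_mult_distrib sum_distrib_left[symmetric]
  by (subst euclidean_inner) (simp add: power2_eq_square)

lemma grushin_grad_norm_eq:
  "grushin_grad_norm \<gamma> f z = sqrt ((norm (grad_fst f z))\<^sup>2 + norm (fst z) ^ (2 * \<gamma>) * (norm (grad_snd f z))\<^sup>2)"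
  by (simp add: grushin_grad_norm_def grad_fst_def grad_snd_def norm_sum_Basis)

lemma has_derivative_dil:
  assumes "(f has_derivative D) (at z)"
  shows "((\<lambda>\<tau>. f (dil a b \<tau> z)) has_real_derivative D (a *\<^sub>R fst z, b *\<^sub>R snd z)) (at 0)"
proof -
  have "((\<lambda>\<tau>. dil a b \<tau> z) has_derivative (\<lambda>h. ((h * a) *\<^sub>R fst z, (h * b) *\<^sub>R snd z))) (at 0)"
  proof -
    have "((\<lambda>\<tau>. exp (c * \<tau>)) has_derivative (\<lambda>h. h * c)) (at 0)" for c :: real
    proof -
      have "((\<lambda>\<tau>. exp (c * \<tau>)) has_real_derivative c) (at 0)"
        by (auto intro!: derivative_eq_intros)
      then show ?thesis by (simp add: has_field_derivative_def mult_commute_abs)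
    qed
    then show ?thesis
      unfolding dil_def by (intro has_derivative_Pair has_derivative_scaleR_left)
  qed
  then have "((\<lambda>\<tau>. f (dil a b \<tau> z)) has_derivative (\<lambda>h. D ((h * a) *\<^sub>R fst z, (h * b) *\<^sub>R snd z))) (at 0)"
    by (rule has_derivative_compose) (simp add: assms)
  moreover have "D ((h * a) *\<^sub>R fst z, (h * b) *\<^sub>R snd z) = D (a *\<^sub>R fst z, b *\<^sub>R snd z) * h" for h
  proof -
    have "((h * a) *\<^sub>R fst z, (h * b) *\<^sub>R snd z) = h *\<^sub>R (a *\<^sub>R fst z, b *\<^sub>R snd z)" by simp
    then show ?thesis
      using linear_scale[OF has_derivative_linear[OF assms], of h "(a *\<^sub>R fst z, b *\<^sub>R snd z)"] by simp
  qed
  ultimately show ?thesis by (simp add: has_field_derivative_def)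
qed

lemma gauge_has_derivative:
  assumes "fst z \<noteq> 0"
  shows "(gauge \<gamma> has_derivative (\<lambda>v. (norm (fst z) ^ (2 * \<gamma>) * (fst z \<bullet> fst v) + (1 + real \<gamma>) * (snd z \<bullet> snd v))
            / gauge \<gamma> z ^ (2 * \<gamma> + 1))) (at z)"
proof -
  \<comment> \<open>Inner products in place of norms keep this expression visibly differentiable
    where y = 0.\<close>
  define P where "P = (\<lambda>z :: (real^'a) \<times> (real^'b). (fst z \<bullet> fst z) ^ (1 + \<gamma>) + (1 + real \<gamma>)\<^sup>2 * (snd z \<bullet> snd z))"
  define e where "e = 1 / (2 * (1 + real \<gamma>))"
  have g: "gauge \<gamma> z = P z powr e" for z
    by (simp add: gauge_def P_def e_def power2_norm_eq_inner[symmetric] power_mult[symmetric] del: power_Suc)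
  have gp: "gauge \<gamma> z > 0" using assms by (rule gauge_pos)
  have PP: "P z = gauge \<gamma> z ^ (2 * (1 + \<gamma>))"
    by (simp only: gauge_pow) (simp add: P_def power2_norm_eq_inner[symmetric] power_mult[symmetric] del: power_Suc)
  have Ppos: "P z > 0" unfolding PP using gp by simp
  have dP: "(P has_derivative (\<lambda>v. 2 * (1 + real \<gamma>) * ((fst z \<bullet> fst z) ^ \<gamma> * (fst z \<bullet> fst v) + (1 + real \<gamma>) * (snd z \<bullet> snd v)))) (at z)"
  proof -
    have a: "((\<lambda>z. fst z \<bullet> fst z) has_derivative (\<lambda>v. 2 * (fst z \<bullet> fst v))) (at z)"
      by (auto intro!: derivative_eq_intros simp: inner_commute)
    have b: "((\<lambda>z. (1 + real \<gamma>)\<^sup>2 * (snd z \<bullet> snd z)) has_derivative (\<lambda>v. (1 + real \<gamma>)\<^sup>2 * (2 * (snd z \<bullet> snd v)))) (at z)"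
      by (auto intro!: derivative_eq_intros simp: inner_commute)
    show ?thesis
      unfolding P_def
      by (rule has_derivative_eq_rhs[OF has_derivative_add[OF has_derivative_power[OF a] b]])
         (simp add: fun_eq_iff algebra_simps power2_eq_square)
  qed
  have "((\<lambda>p. p powr e) has_field_derivative e * P z powr (e - 1)) (at (P z))"
    using Ppos by (auto intro!: derivative_eq_intros)
  then have "((\<lambda>p. p powr e) has_derivative (*) (e * P z powr (e - 1))) (at (P z))"
    by (simp add: has_field_derivative_def)
  from has_derivative_compose[OF dP this]
  have "(gauge \<gamma> has_derivative (\<lambda>v. e * P z powr (e - 1) *
     (2 * (1 + real \<gamma>) * ((fst z \<bullet> fst z) ^ \<gamma> * (fst z \<bullet> fst v) + (1 + real \<gamma>) * (snd z \<bullet> snd v))))) (at z)"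
    unfolding g[abs_def] .
  \<comment> \<open>The left side is \<rho> / P, and P is the power 2 (1 + \<gamma>) of
    \<rho>.\<close>
  moreover have "P z powr (e - 1) = 1 / gauge \<gamma> z ^ (2 * \<gamma> + 1)"
    using Ppos gp by (simp add: powr_diff g[symmetric]) (simp add: PP)
  moreover have "(fst z \<bullet> fst z) ^ \<gamma> = norm (fst z) ^ (2 * \<gamma>)"
    by (simp add: power2_norm_eq_inner[symmetric] power_mult[symmetric])
  moreover have "e * (2 * (1 + real \<gamma>)) = 1" by (simp add: e_def)
  ultimately have *: "(gauge \<gamma> has_derivative (\<lambda>v. e * (1 / gauge \<gamma> z ^ (2 * \<gamma> + 1)) *
     (2 * (1 + real \<gamma>) * (norm (fst z) ^ (2 * \<gamma>) * (fst z \<bullet> fst v) + (1 + real \<gamma>) * (snd z \<bullet> snd v))))) (at z)"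
    by (simp only:)
  have "e * (1 / G) * (2 * (1 + real \<gamma>) * w) = w / G" for G w
  proof -
    have "e * (1 / G) * (2 * (1 + real \<gamma>) * w) = (e * (2 * (1 + real \<gamma>))) * w / G" by (simp only: mult_ac times_divide_eq_left times_divide_eq_right mult_1_left mult_1_right)
    then show ?thesis by (simp only: \<open>e * (2 * (1 + real \<gamma>)) = 1\<close> mult_1_left)
  qed
  with * show ?thesis by (simp only:)
qed

text \<open>The logarithmic derivative of the gauge along the flow \<open>(x, y) \<mapsto> (e\<^sup>\<tau> x, y)\<close>.\<close>

definition \<theta> :: "nat \<Rightarrow> (real^'m::finite) \<times> (real^'k::finite) \<Rightarrow> real" where
  "\<theta> \<gamma> z = (norm (fst z) / gauge \<gamma> z) ^ (2 * \<gamma> + 2)"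

lemma gauge_deriv_fst:
  assumes "fst z \<noteq> 0"
  shows "((\<lambda>\<tau>. gauge \<gamma> (dil 1 0 \<tau> z)) has_real_derivative \<theta> \<gamma> z * gauge \<gamma> z) (at 0)"
proof -
  have g: "gauge \<gamma> z > 0" using assms by (rule gauge_pos)
  have "\<theta> \<gamma> z * gauge \<gamma> z = norm (fst z) ^ (2 * \<gamma>) * (fst z \<bullet> fst z) / gauge \<gamma> z ^ (2 * \<gamma> + 1)"
    using g by (simp add: \<theta>_def power_divide power2_norm_eq_inner[symmetric] power_add power2_eq_square)
  then show ?thesis
    using has_derivative_dil[OF gauge_has_derivative[OF assms], of \<gamma> 1 0] by simp
qed

text \<open>The x and y contributions to the squared norm have a common factor, and the cofactor is
  again \<open>gauge \<gamma> z ^ (2 * (1 + \<gamma>))\<close>. After cancellation the square of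
  (|x| / \<rho>)^\<gamma> remains.\<close>

lemma grushin_grad_norm_gauge:
  assumes "fst z \<noteq> 0"
  shows "grushin_grad_norm \<gamma> (gauge \<gamma>) z = (norm (fst z) / gauge \<gamma> z) ^ \<gamma>"
proof -
  define s y g where defs: "s = norm (fst z)" "y = norm (snd z)" "g = gauge \<gamma> z"
  have pos: "s > 0" "g > 0" using assms gauge_pos[OF assms, of \<gamma>] by (auto simp: defs)
  have D: "frechet_derivative (gauge \<gamma>) (at z) = (\<lambda>v. (norm (fst z) ^ (2 * \<gamma>) * (fst z \<bullet> fst v) + (1 + real \<gamma>) * (snd z \<bullet> snd v))
            / gauge \<gamma> z ^ (2 * \<gamma> + 1))"
    using frechet_derivative_at[OF gauge_has_derivative[OF assms]] by simp
  have "(\<Sum>b\<in>Basis. (frechet_derivative (gauge \<gamma>) (at z) (b, 0))\<^sup>2) = (s ^ (2 * \<gamma>) / g ^ (2 * \<gamma> + 1))\<^sup>2 * s\<^sup>2"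
    unfolding D defs sum_Basis_inner_sq[symmetric] by simp
  moreover have "(\<Sum>b\<in>Basis. (frechet_derivative (gauge \<gamma>) (at z) (0, b))\<^sup>2) = ((1 + real \<gamma>) / g ^ (2 * \<gamma> + 1))\<^sup>2 * y\<^sup>2"
    unfolding D defs sum_Basis_inner_sq[symmetric] by simp
  ultimately have "grushin_grad_norm \<gamma> (gauge \<gamma>) z
      = sqrt ((s ^ (2 * \<gamma>) / g ^ (2 * \<gamma> + 1))\<^sup>2 * s\<^sup>2 + s ^ (2 * \<gamma>) * (((1 + real \<gamma>) / g ^ (2 * \<gamma> + 1))\<^sup>2 * y\<^sup>2))"
    by (simp add: grushin_grad_norm_def defs)
  also have "(s ^ (2 * \<gamma>) / g ^ (2 * \<gamma> + 1))\<^sup>2 * s\<^sup>2 + s ^ (2 * \<gamma>) * (((1 + real \<gamma>) / g ^ (2 * \<gamma> + 1))\<^sup>2 * y\<^sup>2)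
      = s ^ (2 * \<gamma>) / (g ^ (2 * \<gamma> + 1))\<^sup>2 * (s ^ (2 * (1 + \<gamma>)) + (1 + real \<gamma>)\<^sup>2 * y\<^sup>2)"
    by (simp add: power_divide power_mult_distrib power2_eq_square algebra_simps add_divide_distrib)
  also have "s ^ (2 * (1 + \<gamma>)) + (1 + real \<gamma>)\<^sup>2 * y\<^sup>2 = g ^ (2 * (1 + \<gamma>))"
    unfolding defs gauge_pow ..
  also have "s ^ (2 * \<gamma>) / (g ^ (2 * \<gamma> + 1))\<^sup>2 * g ^ (2 * (1 + \<gamma>)) = ((s / g) ^ \<gamma>)\<^sup>2"
  proof -
    have "(g ^ (2 * \<gamma> + 1))\<^sup>2 = g ^ (2 * \<gamma>) * g ^ (2 * (1 + \<gamma>))"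
      unfolding power_mult[symmetric] power_add[symmetric] by (rule arg_cong[of _ _ "\<lambda>n. g ^ n"]) simp
    then show ?thesis using pos by (simp add: power_divide power_mult[symmetric] mult.commute del: power_Suc)
  qed
  finally show ?thesis using pos by (simp add: defs)
qed

lemma wt_deriv_dil: "((\<lambda>\<tau>. wt \<gamma> \<beta> \<eta> (dil 1 (1 + real \<gamma>) \<tau> z)) has_real_derivative \<beta> * wt \<gamma> \<beta> \<eta> z) (at 0)"
  unfolding wt_dil by (auto intro!: derivative_eq_intros)

text \<open>For x \<noteq> 0 the weight is \<rho> to the power \<beta> - \<eta> times |x| to the
  power \<eta>. Along this flow the logarithmic derivatives of the two factors are (\<beta> -
  \<eta>) \<theta> and \<eta>.\<close>

lemma wt_deriv_fst:
  assumes "fst z \<noteq> 0"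
  shows "((\<lambda>\<tau>. wt \<gamma> \<beta> \<eta> (dil 1 0 \<tau> z)) has_real_derivative (\<beta> * \<theta> \<gamma> z + \<eta> * (1 - \<theta> \<gamma> z)) * wt \<gamma> \<beta> \<eta> z) (at 0)"
proof -
  define g where "g = (\<lambda>\<tau>. gauge \<gamma> (dil 1 0 \<tau> z))"
  have gpos: "g \<tau> > 0" for \<tau> using assms by (simp add: g_def gauge_pos)
  have s: "norm (fst z) > 0" using assms by simp
  have geq: "gauge \<gamma> (dil 1 0 \<tau> z) = g \<tau>" for \<tau> by (simp add: g_def)
  have eq: "wt \<gamma> \<beta> \<eta> (dil 1 0 \<tau> z) = g \<tau> powr (\<beta> - \<eta>) * (exp (\<eta> * \<tau>) * norm (fst z) powr \<eta>)" for \<tau>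
    using gpos[of \<tau>] s
    by (simp add: wt_def geq powr_divide powr_diff powr_mult exp_powr_real mult.commute)
  define h where "h = \<theta> \<gamma> z"
  have dg: "(g has_real_derivative h * g 0) (at 0)"
    using gauge_deriv_fst[OF assms, of \<gamma>] by (simp only: g_def h_def dil_0)
  have "((\<lambda>\<tau>. g \<tau> powr (\<beta> - \<eta>)) has_real_derivative (\<beta> - \<eta>) * g 0 powr (\<beta> - \<eta> - 1) * (h * g 0)) (at 0)"
    by (rule DERIV_chain2[OF has_real_derivative_powr[OF gpos] dg])
  also have "(\<beta> - \<eta>) * g 0 powr (\<beta> - \<eta> - 1) * (h * g 0) = (\<beta> - \<eta>) * h * g 0 powr (\<beta> - \<eta>)"
    using gpos[of 0] by (simp add: powr_diff)
  finally have d1: "((\<lambda>\<tau>. g \<tau> powr (\<beta> - \<eta>)) has_real_derivative (\<beta> - \<eta>) * h * g 0 powr (\<beta> - \<eta>)) (at 0)" .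
  have d2: "((\<lambda>\<tau>. exp (\<eta> * \<tau>) * norm (fst z) powr \<eta>) has_real_derivative \<eta> * norm (fst z) powr \<eta>) (at 0)"
    by (auto intro!: derivative_eq_intros)
  have w: "wt \<gamma> \<beta> \<eta> z = g 0 powr (\<beta> - \<eta>) * norm (fst z) powr \<eta>" using eq[of 0] by simp
  show ?thesis unfolding eq w h_def[symmetric]
    by (rule DERIV_cong[OF DERIV_mult[OF d1 d2]]) (simp add: algebra_simps)
qed

section \<open>Test functions: continuity, gradients and vanishing off the support\<close>

lemma bounded_compact_support:
  fixes f :: "'a::euclidean_space \<Rightarrow> 'b::real_normed_vector"
  assumes "continuous_on UNIV f" "compact K" "\<And>z. z \<notin> K \<Longrightarrow> f z = 0"
  obtains M where "\<And>z. norm (f z) \<le> M"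
proof -
  have "bounded (f ` K)"
    using assms by (intro compact_imp_bounded compact_continuous_image) (auto intro: continuous_on_subset)
  then obtain M where "\<And>z. z \<in> K \<Longrightarrow> norm (f z) \<le> M" by (auto simp: bounded_iff)
  then have "norm (f z) \<le> max M 0" for z
    using assms(3)[of z] by (cases "z \<in> K") (auto simp: le_max_iff_disj)
  then show ?thesis using that by blast
qed

lemma test_fun_differentiable: "test_fun U f \<Longrightarrow> f differentiable (at z)"
  and test_fun_continuous: "test_fun U f \<Longrightarrow> continuous_on UNIV f"
  and test_fun_continuous_deriv:
    "test_fun U f \<Longrightarrow> b \<in> Basis \<Longrightarrow> continuous_on UNIV (\<lambda>z. frechet_derivative f (at z) b)"
proof -
  assume "test_fun U f"
  then have "Ck_fun (Suc 0) f" by (simp add: test_fun_def smooth_fun_def)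
  then show "f differentiable (at z)" "continuous_on UNIV f"
    "b \<in> Basis \<Longrightarrow> continuous_on UNIV (\<lambda>z. frechet_derivative f (at z) b)"
    by (auto simp: differentiable_on_def)
qed

lemma continuous_on_grad_fst: "test_fun U f \<Longrightarrow> continuous_on UNIV (grad_fst f)"
  and continuous_on_grad_snd: "test_fun U f \<Longrightarrow> continuous_on UNIV (grad_snd f)"
  unfolding grad_fst_def[abs_def] grad_snd_def[abs_def]
  by (auto intro!: continuous_intros test_fun_continuous_deriv simp: Basis_prod_def)

lemma test_fun_has_derivative:
  assumes "test_fun U f"
  shows "(f has_derivative (\<lambda>v. grad_fst f z \<bullet> fst v + grad_snd f z \<bullet> snd v)) (at z)"
  using frechet_derivative_works[of f "at z"] frechet_derivative_eq_grad[of f z] test_fun_differentiable[OF assms]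
  by (metis (no_types, lifting) ext)

lemma test_fun_vanish:
  assumes "test_fun U f" and z: "z \<notin> closure {z. f z \<noteq> 0}"
  shows "f z = 0" "grad_fst f z = 0" "grad_snd f z = 0" "\<forall>\<^sub>F w in nhds z. f w = 0"
proof -
  have sub: "{z. f z \<noteq> 0} \<subseteq> closure {z. f z \<noteq> 0}" by (rule closure_subset)
  show "f z = 0" using z sub by blast
  have op: "open (- closure {z. f z \<noteq> 0})" by auto
  then show ev: "\<forall>\<^sub>F w in nhds z. f w = 0"
    unfolding eventually_nhds using z sub by (intro exI[of _ "- closure {z. f z \<noteq> 0}"]) auto
  have "((\<lambda>_. 0) has_derivative (\<lambda>_. 0)) (at z)" by simp
  then have "(f has_derivative (\<lambda>_. 0)) (at z)"
    by (rule has_derivative_transform_within_open[OF _ op]) (use z sub in auto)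
  then have "frechet_derivative f (at z) = (\<lambda>_. 0)" by (simp add: frechet_derivative_at[symmetric])
  then show "grad_fst f z = 0" "grad_snd f z = 0" by (simp_all add: grad_fst_def grad_snd_def)
qed

subsection \<open>The weighted Hardy inequality\<close>

text \<open>As a predicate on functions, boundedness can be derived by closure rules that follow the
  shape of the integrand.\<close>

definition bounded_fun_on :: "'a set \<Rightarrow> ('a \<Rightarrow> real) \<Rightarrow> bool" where
  "bounded_fun_on S f \<longleftrightarrow> (\<exists>M. \<forall>z\<in>S. \<bar>f z\<bar> \<le> M)"

lemma bounded_fun_onI: "(\<And>z. z \<in> S \<Longrightarrow> \<bar>f z\<bar> \<le> M) \<Longrightarrow> bounded_fun_on S f"
  by (auto simp: bounded_fun_on_def)

lemma bounded_fun_on_const: "bounded_fun_on S (\<lambda>_. c)"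
  by (auto simp: bounded_fun_on_def)

lemma bounded_fun_on_add: "bounded_fun_on S f \<Longrightarrow> bounded_fun_on S g \<Longrightarrow> bounded_fun_on S (\<lambda>z. f z + g z)"
  unfolding bounded_fun_on_def by (metis abs_triangle_ineq add_mono order_trans)

lemma bounded_fun_on_minus: "bounded_fun_on S f \<Longrightarrow> bounded_fun_on S (\<lambda>z. - f z)"
  unfolding bounded_fun_on_def by simp

lemma bounded_fun_on_diff: "bounded_fun_on S f \<Longrightarrow> bounded_fun_on S g \<Longrightarrow> bounded_fun_on S (\<lambda>z. f z - g z)"
  using bounded_fun_on_add[OF _ bounded_fun_on_minus] by fastforce

lemma bounded_fun_on_mult:
  assumes "bounded_fun_on S f" "bounded_fun_on S g"
  shows "bounded_fun_on S (\<lambda>z. f z * g z)"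
proof -
  obtain M N where MN: "\<And>z. z \<in> S \<Longrightarrow> \<bar>f z\<bar> \<le> M" "\<And>z. z \<in> S \<Longrightarrow> \<bar>g z\<bar> \<le> N"
    using assms by (auto simp: bounded_fun_on_def)
  have "\<bar>f z * g z\<bar> \<le> \<bar>M\<bar> * \<bar>N\<bar>" if "z \<in> S" for z
    unfolding abs_mult by (rule mult_mono) (use MN[OF that] in auto)
  then show ?thesis by (rule bounded_fun_onI)
qed

lemma bounded_fun_on_power: "bounded_fun_on S f \<Longrightarrow> bounded_fun_on S (\<lambda>z. f z ^ n)"
  by (induction n) (auto intro: bounded_fun_on_const bounded_fun_on_mult)

lemmas bounded_fun_on_intros = bounded_fun_on_const bounded_fun_on_add bounded_fun_on_minus
  bounded_fun_on_diff bounded_fun_on_mult bounded_fun_on_power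

lemma integrable_wt_bounded:
  fixes k :: "(real^'m::finite) \<times> (real^'k::finite) \<Rightarrow> real"
  assumes "hom_dim CARD('m) CARD('k) \<gamma> + \<beta> > 0" "real CARD('m) + \<eta> > 0" "R > 0"
    and "k \<in> borel_measurable borel" "bounded_fun_on (gauge_ball \<gamma> R) k"
    and "\<And>z. z \<notin> gauge_ball \<gamma> R \<Longrightarrow> k z = 0"
  shows "integrable lborel (\<lambda>z. wt \<gamma> \<beta> \<eta> z * k z)"
proof -
  obtain M where "\<And>z. z \<in> gauge_ball \<gamma> R \<Longrightarrow> \<bar>k z\<bar> \<le> M"
    using assms(5) by (auto simp: bounded_fun_on_def)
  then show ?thesis by (intro integrable_wt_mult[OF assms(1-4,6)])
qed

lemma theta_nonneg: "\<theta> \<gamma> z \<ge> 0"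
  by (simp add: \<theta>_def gauge_nonneg)

lemma theta_le_1: "\<theta> \<gamma> z \<le> 1"
  unfolding \<theta>_def by (rule power_le_one) (auto simp: norm_fst_le_gauge gauge_nonneg divide_le_eq_1 less_le)

lemma measurable_theta [measurable]: "\<theta> \<gamma> \<in> borel_measurable borel"
  unfolding \<theta>_def by (intro borel_measurable_power borel_measurable_divide measurable_gauge
      borel_measurable_continuous_onI continuous_intros)

text \<open>Weighted integration by parts along the dilations adapted to \<rho>: the generator has
  divergence Q and the weight is homogeneous of degree \<beta>, so together they contribute the
  constant \<beta> + Q.\<close>

lemma
  fixes k kd :: "(real^'m::finite) \<times> (real^'k::finite) \<Rightarrow> real"
  assumes pos: "hom_dim CARD('m) CARD('k) \<gamma> + \<beta> > 0" "real CARD('m) + \<eta> > 0" "R > 0"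
    and k: "k \<in> borel_measurable borel" "bounded_fun_on (gauge_ball \<gamma> R) k"
      "\<And>z. z \<notin> gauge_ball \<gamma> R \<Longrightarrow> k z = 0"
    and kd: "kd \<in> borel_measurable borel" "bounded_fun_on (gauge_ball \<gamma> R) kd"
      "\<And>z. z \<notin> gauge_ball \<gamma> R \<Longrightarrow> kd z = 0"
    and deriv: "\<And>z. fst z \<noteq> 0 \<Longrightarrow> ((\<lambda>\<tau>. k (dil 1 (1 + real \<gamma>) \<tau> z)) has_real_derivative kd z) (at 0)"
  shows integrable_wt_dil: "integrable lborel
      (\<lambda>z. wt \<gamma> \<beta> \<eta> z * ((\<beta> + hom_dim CARD('m) CARD('k) \<gamma>) * k z + kd z))"
    and integral_wt_dil: "(\<integral>z. wt \<gamma> \<beta> \<eta> z * ((\<beta> + hom_dim CARD('m) CARD('k) \<gamma>) * k z + kd z) \<partial>lborel) = 0"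
proof -
  let ?Q = "hom_dim CARD('m) CARD('k) \<gamma>"
  have i1: "integrable lborel (\<lambda>z. wt \<gamma> \<beta> \<eta> z * k z)"
    by (rule integrable_wt_bounded[OF pos k])
  have i2: "integrable lborel (\<lambda>z. wt \<gamma> \<beta> \<eta> z * (\<beta> * k z + kd z))"
    by (rule integrable_wt_bounded[OF pos]) (use k kd in \<open>auto intro!: bounded_fun_on_intros\<close>)
  have eq: "wt \<gamma> \<beta> \<eta> z * ((\<beta> + ?Q) * k z + kd z)
      = wt \<gamma> \<beta> \<eta> z * (\<beta> * k z + kd z) + ?Q * (wt \<gamma> \<beta> \<eta> z * k z)" for z
    by (simp add: algebra_simps)
  show "integrable lborel (\<lambda>z. wt \<gamma> \<beta> \<eta> z * ((\<beta> + ?Q) * k z + kd z))"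
    unfolding eq using i1 i2 by simp
  have "(\<integral>z. wt \<gamma> \<beta> \<eta> z * (\<beta> * k z + kd z) \<partial>lborel) = - ?Q * (\<integral>z. wt \<gamma> \<beta> \<eta> z * k z \<partial>lborel)"
  proof (rule integral_flow_derivative[OF i1 i2, where a = 1 and b = "1 + real \<gamma>" and G = "{z. fst z \<noteq> 0}"])
    have "real CARD('m) > 0" by simp
    then show "0 < ?Q" unfolding hom_dim_def by (intro add_pos_nonneg) auto
    fix z :: "(real^'m) \<times> (real^'k)" assume "z \<in> {z. fst z \<noteq> 0}"
    then show "((\<lambda>\<tau>. wt \<gamma> \<beta> \<eta> (dil 1 (1 + real \<gamma>) \<tau> z) * k (dil 1 (1 + real \<gamma>) \<tau> z))
        has_real_derivative wt \<gamma> \<beta> \<eta> z * (\<beta> * k z + kd z)) (at 0)"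
      by (intro DERIV_cong[OF DERIV_mult[OF wt_deriv_dil deriv]]) (auto simp: algebra_simps)
  qed (use AE_fst_nonzero in \<open>auto simp: hom_dim_def\<close>)
  then show "(\<integral>z. wt \<gamma> \<beta> \<eta> z * ((\<beta> + ?Q) * k z + kd z) \<partial>lborel) = 0"
    unfolding eq using i1 i2 by simp
qed

text \<open>The same along the flow that scales x alone. Its divergence is m, and the logarithmic
  derivative of the weight is no longer constant but involves \<theta>, which lies in
  [0, 1].\<close>

lemma
  fixes k kd :: "(real^'m::finite) \<times> (real^'k::finite) \<Rightarrow> real"
  assumes pos: "hom_dim CARD('m) CARD('k) \<gamma> + \<beta> > 0" "real CARD('m) + \<eta> > 0" "R > 0"
    and k: "k \<in> borel_measurable borel" "bounded_fun_on (gauge_ball \<gamma> R) k"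
      "\<And>z. z \<notin> gauge_ball \<gamma> R \<Longrightarrow> k z = 0"
    and kd: "kd \<in> borel_measurable borel" "bounded_fun_on (gauge_ball \<gamma> R) kd"
      "\<And>z. z \<notin> gauge_ball \<gamma> R \<Longrightarrow> kd z = 0"
    and deriv: "\<And>z. fst z \<noteq> 0 \<Longrightarrow> ((\<lambda>\<tau>. k (dil 1 0 \<tau> z)) has_real_derivative kd z) (at 0)"
  shows integrable_wt_fst: "integrable lborel
      (\<lambda>z. wt \<gamma> \<beta> \<eta> z * ((\<beta> * \<theta> \<gamma> z + \<eta> * (1 - \<theta> \<gamma> z) + real CARD('m)) * k z + kd z))"
    and integral_wt_fst:
      "(\<integral>z. wt \<gamma> \<beta> \<eta> z * ((\<beta> * \<theta> \<gamma> z + \<eta> * (1 - \<theta> \<gamma> z) + real CARD('m)) * k z + kd z) \<partial>lborel) = 0"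
proof -
  have th: "bounded_fun_on (gauge_ball \<gamma> R) (\<theta> \<gamma> :: (real^'m) \<times> (real^'k) \<Rightarrow> real)"
    by (rule bounded_fun_onI[of _ _ 1]) (simp only: abs_of_nonneg[OF theta_nonneg] theta_le_1)
  define E where "E = (\<lambda>z :: (real^'m) \<times> (real^'k). \<beta> * \<theta> \<gamma> z + \<eta> * (1 - \<theta> \<gamma> z))"
  have Ez: "\<beta> * \<theta> \<gamma> z + \<eta> * (1 - \<theta> \<gamma> z) = E z" for z by (simp only: E_def)
  have E: "bounded_fun_on (gauge_ball \<gamma> R) E"
    unfolding E_def by (intro bounded_fun_on_intros th)
  have [measurable]: "E \<in> borel_measurable borel"
    unfolding E_def by (intro borel_measurable_add borel_measurable_times borel_measurable_diff
        borel_measurable_const measurable_theta)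
  have i1: "integrable lborel (\<lambda>z. wt \<gamma> \<beta> \<eta> z * k z)"
    by (rule integrable_wt_bounded[OF pos k])
  have i2: "integrable lborel (\<lambda>z. wt \<gamma> \<beta> \<eta> z * (E z * k z + kd z))"
    by (rule integrable_wt_bounded[OF pos]) (use k kd E in \<open>auto intro!: bounded_fun_on_intros\<close>)
  have eq: "wt \<gamma> \<beta> \<eta> z * ((E z + real CARD('m)) * k z + kd z)
      = wt \<gamma> \<beta> \<eta> z * (E z * k z + kd z) + real CARD('m) * (wt \<gamma> \<beta> \<eta> z * k z)" for z
    by (simp add: algebra_simps)
  show "integrable lborel
      (\<lambda>z. wt \<gamma> \<beta> \<eta> z * ((\<beta> * \<theta> \<gamma> z + \<eta> * (1 - \<theta> \<gamma> z) + real CARD('m)) * k z + kd z))"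
    unfolding Ez unfolding eq using i1 i2 by simp
  have "(\<integral>z. wt \<gamma> \<beta> \<eta> z * (E z * k z + kd z) \<partial>lborel) = - real CARD('m) * (\<integral>z. wt \<gamma> \<beta> \<eta> z * k z \<partial>lborel)"
  proof (rule integral_flow_derivative[OF i1 i2, where a = 1 and b = 0 and G = "{z. fst z \<noteq> 0}"])
    fix z :: "(real^'m) \<times> (real^'k)" assume "z \<in> {z. fst z \<noteq> 0}"
    then show "((\<lambda>\<tau>. wt \<gamma> \<beta> \<eta> (dil 1 0 \<tau> z) * k (dil 1 0 \<tau> z))
        has_real_derivative wt \<gamma> \<beta> \<eta> z * (E z * k z + kd z)) (at 0)"
      unfolding E_def
      by (intro DERIV_cong[OF DERIV_mult[OF wt_deriv_fst deriv]]) (auto simp: algebra_simps simp del: power_Suc)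
  qed (use AE_fst_nonzero in \<open>auto\<close>)
  then show "(\<integral>z. wt \<gamma> \<beta> \<eta> z * ((\<beta> * \<theta> \<gamma> z + \<eta> * (1 - \<theta> \<gamma> z) + real CARD('m)) * k z + kd z) \<partial>lborel) = 0"
    unfolding Ez unfolding eq using i1 i2 by simp
qed

lemma flow_derivative_vanish:
  assumes "\<forall>\<^sub>F w in nhds z. h w = (0::real)"
  shows "((\<lambda>\<tau>. h (dil a b \<tau> z)) has_real_derivative 0) (at 0)"
proof -
  have "isCont (\<lambda>\<tau>. dil a b \<tau> z) 0"
    unfolding dil_def by (intro continuous_intros)
  then have "filterlim (\<lambda>\<tau>. dil a b \<tau> z) (nhds z) (nhds 0)"
    by (simp add: continuous_at_imp_continuous_at_within isCont_def tendsto_nhds_iff)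
  then have "\<forall>\<^sub>F \<tau> in nhds 0. h (dil a b \<tau> z) = 0"
    using assms by (rule eventually_compose_filterlim[rotated])
  then show ?thesis by (subst DERIV_cong_ev[where g = "\<lambda>_. 0"]) auto
qed

text \<open>This is |p - c x|^2 \<ge> 0 expanded. It will be applied separately to the two gradient
  components of \<phi>, as those of \<phi> times the logarithmic gradient of U are multiples of x
  and y.\<close>

lemma young_inner:
  fixes p x :: "'a::real_inner"
  shows "(norm p)\<^sup>2 \<ge> 2 * c * (p \<bullet> x) - c\<^sup>2 * (norm x)\<^sup>2"
proof -
  have "0 \<le> (p - c *\<^sub>R x) \<bullet> (p - c *\<^sub>R x)" by simp
  then show ?thesis
    unfolding power2_norm_eq_inner
    by (simp add: inner_diff_left inner_diff_right inner_commute power2_eq_square algebra_simps)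
qed

text \<open>
  Here \<open>s2 = |x|\<^sup>2\<close>, \<open>r2 = \<rho>\<^sup>2\<close>, \<open>\<psi>\<close> is the square of \<open>|\<nabla>\<^sub>\<gamma> \<rho>|\<close>, \<open>v = 1 / u\<close>, and \<open>X\<close>, \<open>X + (1 + g) Y\<close> are the
  derivatives of \<open>\<phi>\<close> along the two flows; the last two summands on the right are the flow divergences
  that integrate to zero.
\<close>

lemma supersolution_identity:
  fixes s2 r2 i :: real
  assumes "i * r2 = 1" "th = \<psi> * s2 * i" "K = c + 2 * B * r2 * v" "2 * c = m + (1 + g) * k + \<alpha> - 2"
  shows "2 * \<phi> * (- (K * i * \<psi> + 2 * v) * X - K * i * (1 + g) * \<psi> * Y)
      - \<phi>\<^sup>2 * ((K * i * \<psi> + 2 * v)\<^sup>2 * s2 + (K * i)\<^sup>2 * \<psi> * (r2 - \<psi> * s2))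
    = \<phi>\<^sup>2 * (c\<^sup>2 * \<psi> * i + v * (4 * B * \<psi> + 2 * (m + t * g) - 2 * (m + (1 + g) * k - 2 + t * g) * th))
      + \<psi> * i * (2 * c * - (K * \<phi>\<^sup>2) - ((4 * B * r2 * v + 4 * B * r2 * (B * r2 + s2) * v\<^sup>2) * \<phi>\<^sup>2 + 2 * K * \<phi> * (X + (1 + g) * Y)))
      + ((\<alpha> * th + g * t * (1 - th) + m) * (- 2 * v * \<phi>\<^sup>2)
          - 2 * ((2 * B * th * r2 + 2 * s2) * v\<^sup>2 * \<phi>\<^sup>2 + 2 * v * \<phi> * X))"
proof -
  \<comment> \<open>Eliminating \<alpha> in favour of c and cancelling i against \<open>r2\<close>
    leaves a polynomial identity.\<close>
  have \<alpha>: "\<alpha> = 2 * c + 2 - m - (1 + g) * k" using assms(4) by simp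
  have r: "i * (r2 * x) = x" "r2 * (i * x) = x" for x using assms(1) by (auto simp: mult.assoc[symmetric] mult.commute)
  show ?thesis unfolding \<alpha> assms(2,3) 
    by (simp add: algebra_simps power2_eq_square r assms(1))
qed


lemma grushin_hardy_integral:
  fixes \<phi> :: "(real^'m::finite) \<times> (real^'k::finite) \<Rightarrow> real"
  assumes r: "r > 0" and \<phi>: "test_fun (gauge_ball \<gamma> r) \<phi>"
    and t: "real CARD('m) + real \<gamma> * t > 0"
    and Q: "hom_dim CARD('m) CARD('k) \<gamma> + \<alpha> - 2 > 0"
  defines "c \<equiv> (hom_dim CARD('m) CARD('k) \<gamma> + \<alpha> - 2) / 2"
    and "B \<equiv> \<bar>hom_dim CARD('m) CARD('k) \<gamma> - 2 + t * real \<gamma>\<bar> / 2"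
  defines "G \<equiv> \<lambda>z. (norm (grad_fst \<phi> z))\<^sup>2 + norm (fst z) ^ (2 * \<gamma>) * (norm (grad_snd \<phi> z))\<^sup>2"
    and "w \<equiv> wt \<gamma> \<alpha> (real \<gamma> * t)" and "w' \<equiv> wt \<gamma> (\<alpha> - 2) (real \<gamma> * (t + 2))"
  shows "integrable lborel (\<lambda>z. w z * G z)"
    and "integrable lborel (\<lambda>z. w' z * (\<phi> z)\<^sup>2)" and "integrable lborel (\<lambda>z. w z * (\<phi> z)\<^sup>2)"
    and "(\<integral>z. w z * G z \<partial>lborel) \<ge> c\<^sup>2 * (\<integral>z. w' z * (\<phi> z)\<^sup>2 \<partial>lborel)
      + (real CARD('m) + real \<gamma> * t) / ((B + 1) * r\<^sup>2) * (\<integral>z. w z * (\<phi> z)\<^sup>2 \<partial>lborel)"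
proof -
  let ?S = "gauge_ball \<gamma> r :: ((real^'m) \<times> (real^'k)) set"
  let ?m = "real CARD('m)" and ?Q = "hom_dim CARD('m) CARD('k) \<gamma>" and ?\<eta> = "real \<gamma> * t"
  \<comment> \<open>The constant term keeps u between (B + 1) r^2 and 2 (B + 1) r^2 on the
    ball.\<close>
  define u where "u = (\<lambda>z :: (real^'m) \<times> (real^'k). 2 * (B + 1) * r\<^sup>2 - B * (gauge \<gamma> z)\<^sup>2 - (norm (fst z))\<^sup>2)"
  define v where "v = (\<lambda>z. 1 / u z)"
  \<comment> \<open>In the logarithmic gradient of U the coefficient of the gradient of \<rho> is -K
    / \<rho>; the remaining part is -2 v x in the x directions.\<close>
  define K where "K = (\<lambda>z. c + 2 * B * (gauge \<gamma> z)\<^sup>2 * v z)"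
  define X where "X = (\<lambda>z. grad_fst \<phi> z \<bullet> fst z)"
  define Y where "Y = (\<lambda>z. grad_snd \<phi> z \<bullet> snd z)"
  \<comment> \<open>Up to the weights \<open>w'\<close> and \<open>w\<close>, these are the
    coefficients of the two dilation generators in the field \<phi>^2 w grad U / U. Their
    derivatives along the respective flows are \<open>d1\<close> and \<open>d2\<close>.\<close>
  define k1 where "k1 = (\<lambda>z. - (K z * (\<phi> z)\<^sup>2))"
  define k2 where "k2 = (\<lambda>z. - 2 * v z * (\<phi> z)\<^sup>2)"
  define d1 where "d1 = (\<lambda>z. - ((4 * B * (gauge \<gamma> z)\<^sup>2 * v z
      + 4 * B * (gauge \<gamma> z)\<^sup>2 * (B * (gauge \<gamma> z)\<^sup>2 + (norm (fst z))\<^sup>2) * (v z)\<^sup>2) * (\<phi> z)\<^sup>2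
      + 2 * K z * \<phi> z * (X z + (1 + real \<gamma>) * Y z)))"
  define d2 where "d2 = (\<lambda>z. - 2 * ((2 * B * \<theta> \<gamma> z * (gauge \<gamma> z)\<^sup>2 + 2 * (norm (fst z))\<^sup>2) * (v z)\<^sup>2 * (\<phi> z)\<^sup>2
      + 2 * v z * \<phi> z * X z))"
  have B: "B \<ge> 0" by (simp add: B_def)
  have ball: "gauge \<gamma> z < r" "norm (fst z) < r" "u z \<ge> (B + 1) * r\<^sup>2" "u z \<le> 2 * (B + 1) * r\<^sup>2"
    "u z > 0" if "z \<in> ?S" for z
  proof -
    show g: "gauge \<gamma> z < r" using that by (simp add: gauge_ball_def)
    then show n: "norm (fst z) < r" using norm_fst_le_gauge[of z \<gamma>] by linarith
    have g2: "(gauge \<gamma> z)\<^sup>2 \<le> r\<^sup>2" using g gauge_nonneg[of \<gamma> z] by (intro power_mono) auto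
    have n2: "(norm (fst z))\<^sup>2 \<le> r\<^sup>2" using n by (intro power_mono) auto
    have "B * (gauge \<gamma> z)\<^sup>2 \<le> B * r\<^sup>2" using g2 B by (rule mult_left_mono)
    then show "u z \<ge> (B + 1) * r\<^sup>2" using n2 by (simp add: u_def algebra_simps)
    moreover have "(B + 1) * r\<^sup>2 > 0" using B r by simp
    ultimately show "u z > 0" by linarith
    show "u z \<le> 2 * (B + 1) * r\<^sup>2" using B mult_nonneg_nonneg[OF B zero_le_power2[of "gauge \<gamma> z"]] zero_le_power2[of "norm (fst z)"]
      unfolding u_def by linarith
  qed

  have contX: "continuous_on UNIV X" and contY: "continuous_on UNIV Y"
    unfolding X_def Y_def
    by (intro continuous_intros continuous_on_grad_fst[OF \<phi>] continuous_on_grad_snd[OF \<phi>])+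
  have contG: "continuous_on UNIV G"
    unfolding G_def
    by (intro continuous_intros continuous_on_grad_fst[OF \<phi>] continuous_on_grad_snd[OF \<phi>])
  have [measurable]: "X \<in> borel_measurable borel" "Y \<in> borel_measurable borel" "G \<in> borel_measurable borel"
      "\<phi> \<in> borel_measurable borel"
    using contX contY contG test_fun_continuous[OF \<phi>] by (auto intro: borel_measurable_continuous_onI)
  have [measurable]: "(\<lambda>z :: (real^'m) \<times> (real^'k). norm (fst z)) \<in> borel_measurable borel"
    by (intro borel_measurable_continuous_onI continuous_intros)
  have [measurable]: "v \<in> borel_measurable borel" unfolding v_def u_def by measurable
  have [measurable]: "K \<in> borel_measurable borel" unfolding K_def by measurable
  have m: "k1 \<in> borel_measurable borel" "k2 \<in> borel_measurable borel"
    "d1 \<in> borel_measurable borel" "d2 \<in> borel_measurable borel"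
    unfolding k1_def k2_def d1_def d2_def by measurable

  let ?Z = "closure {z. \<phi> z \<noteq> 0}"
  have supp: "compact ?Z" "?Z \<subseteq> ?S" using \<phi> by (auto simp: test_fun_def)
  have bd: "bounded_fun_on ?S f" if "continuous_on UNIV f" "\<And>z. z \<notin> ?Z \<Longrightarrow> f z = 0"
    for f :: "(real^'m) \<times> (real^'k) \<Rightarrow> real"
    using bounded_compact_support[OF that(1) supp(1) that(2)] unfolding bounded_fun_on_def real_norm_def by metis
  note van = test_fun_vanish[OF \<phi>]
  have b\<phi>: "bounded_fun_on ?S \<phi>"
    by (rule bd[OF test_fun_continuous[OF \<phi>] van(1)])
  have bX: "bounded_fun_on ?S X"
    by (rule bd[OF contX]) (simp add: X_def van(2))
  have bY: "bounded_fun_on ?S Y"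
    by (rule bd[OF contY]) (simp add: Y_def van(3))
  have bG: "bounded_fun_on ?S G"
    by (rule bd[OF contG]) (simp add: G_def van(2,3))
  have bg: "bounded_fun_on ?S (gauge \<gamma>)"
    by (rule bounded_fun_onI[of _ _ r]) (use ball(1) in \<open>simp add: less_imp_le gauge_nonneg\<close>)
  have bn: "bounded_fun_on ?S (\<lambda>z. norm (fst z))"
    by (rule bounded_fun_onI[of _ _ r]) (use ball(2) in \<open>simp add: less_imp_le\<close>)
  have bth: "bounded_fun_on ?S (\<theta> \<gamma>)"
    by (rule bounded_fun_onI[of _ _ 1]) (simp only: abs_of_nonneg[OF theta_nonneg] theta_le_1)
  have bv: "bounded_fun_on ?S v"
  proof (rule bounded_fun_onI[of _ _ "1 / ((B + 1) * r\<^sup>2)"])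
    fix z assume z: "z \<in> ?S"
    have "1 / u z \<le> 1 / ((B + 1) * r\<^sup>2)" using ball(3,5)[OF z] B r by (intro divide_left_mono mult_pos_pos) auto
    then show "\<bar>v z\<bar> \<le> 1 / ((B + 1) * r\<^sup>2)" using ball(5)[OF z] by (simp add: v_def)
  qed
  have bK: "bounded_fun_on ?S K" unfolding K_def by (intro bounded_fun_on_intros bg bv)
  have b: "bounded_fun_on ?S k1" "bounded_fun_on ?S k2" "bounded_fun_on ?S d1" "bounded_fun_on ?S d2"
    unfolding k1_def k2_def d1_def d2_def
    by (intro bounded_fun_on_intros b\<phi> bX bY bg bn bv bK bth)+
  have out: "\<phi> z = 0" "G z = 0" if "z \<notin> ?S" for z
  proof -
    have z: "z \<notin> ?Z" using that supp(2) by blast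
    show "\<phi> z = 0" by (rule van(1)[OF z])
    show "G z = 0" by (simp only: G_def van(2)[OF z] van(3)[OF z]) simp
  qed
  have zero: "k1 z = 0" "k2 z = 0" "d1 z = 0" "d2 z = 0" if "z \<notin> ?S" for z
    using out(1)[OF that] by (simp_all add: k1_def k2_def d1_def d2_def)

  \<comment> \<open>Both flows are treated at once: R' and U' are the derivatives of \<rho> and u
    along the flow, with R' = \<rho> for the first flow and R' = \<theta> \<rho> for the
    second.\<close>
  have flow: "((\<lambda>\<tau>. - (K (dil a b \<tau> z) * (\<phi> (dil a b \<tau> z))\<^sup>2)) has_real_derivative
        - ((2 * B * (2 * gauge \<gamma> z * R') * v z - 2 * B * (gauge \<gamma> z)\<^sup>2 * (U' * (v z)\<^sup>2)) * (\<phi> z)\<^sup>2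
           + 2 * K z * \<phi> z * (a * X z + b * Y z))) (at 0)" (is ?f1)
    and flow': "((\<lambda>\<tau>. - 2 * v (dil a b \<tau> z) * (\<phi> (dil a b \<tau> z))\<^sup>2) has_real_derivative
        - 2 * (- U' * (v z)\<^sup>2 * (\<phi> z)\<^sup>2 + 2 * v z * \<phi> z * (a * X z + b * Y z))) (at 0)" (is ?f2)
    if z: "u z > 0" and R': "((\<lambda>\<tau>. gauge \<gamma> (dil a b \<tau> z)) has_real_derivative R') (at 0)"
      and U': "U' = - 2 * B * gauge \<gamma> z * R' - 2 * a * (norm (fst z))\<^sup>2" for z a b R' U'
  proof -
    have F: "((\<lambda>\<tau>. \<phi> (dil a b \<tau> z)) has_real_derivative a * X z + b * Y z) (at 0)"
      using has_derivative_dil[OF test_fun_has_derivative[OF \<phi>], of a b z] by (simp add: X_def Y_def)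
    have N: "((\<lambda>\<tau>. (norm (fst (dil a b \<tau> z)))\<^sup>2) has_real_derivative 2 * a * (norm (fst z))\<^sup>2) (at 0)"
    proof -
      have "((\<lambda>\<tau>. exp (a * \<tau>) ^ 2 * (norm (fst z))\<^sup>2) has_real_derivative 2 * a * (norm (fst z))\<^sup>2) (at 0)"
        by (auto intro!: derivative_eq_intros)
      then show ?thesis by (simp add: power_mult_distrib)
    qed
    have R2: "((\<lambda>\<tau>. (gauge \<gamma> (dil a b \<tau> z))\<^sup>2) has_real_derivative 2 * gauge \<gamma> z * R') (at 0)"
      by (rule DERIV_cong[OF DERIV_power[OF R', of 2]]) simp
    have "((\<lambda>\<tau>. u (dil a b \<tau> z)) has_real_derivative U') (at 0)"
      unfolding u_def
      by (rule DERIV_cong[OF DERIV_diff[OF DERIV_diff[OF DERIV_const DERIV_cmult[OF R2]] N]]) (simp add: U')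
    then have V: "((\<lambda>\<tau>. v (dil a b \<tau> z)) has_real_derivative - U' * (v z)\<^sup>2) (at 0)"
      unfolding v_def
      by (rule DERIV_cong[OF DERIV_divide[OF DERIV_const]]) (use z in \<open>simp_all add: power2_eq_square\<close>)
    have F2: "((\<lambda>\<tau>. (\<phi> (dil a b \<tau> z))\<^sup>2) has_real_derivative 2 * \<phi> z * (a * X z + b * Y z)) (at 0)"
      by (rule DERIV_cong[OF DERIV_power[OF F, of 2]]) simp
    have KK: "((\<lambda>\<tau>. K (dil a b \<tau> z)) has_real_derivative
        2 * B * (2 * gauge \<gamma> z * R') * v z - 2 * B * (gauge \<gamma> z)\<^sup>2 * (U' * (v z)\<^sup>2)) (at 0)"
      unfolding K_def
      by (rule DERIV_cong[OF DERIV_add[OF DERIV_const DERIV_mult[OF DERIV_cmult[OF R2] V]]]) simp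
    show ?f1 by (rule DERIV_cong[OF DERIV_minus[OF DERIV_mult[OF KK F2]]]) simp
    show ?f2 by (rule DERIV_cong[OF DERIV_mult[OF DERIV_cmult[OF V] F2]]) (simp add: algebra_simps)
  qed
  have ev: "\<forall>\<^sub>F w in nhds z. k1 w = 0" "\<forall>\<^sub>F w in nhds z. k2 w = 0" if "z \<notin> ?S" for z
  proof -
    have e: "\<forall>\<^sub>F w in nhds z. \<phi> w = 0" using that supp(2) by (intro van(4)) blast
    show "\<forall>\<^sub>F w in nhds z. k1 w = 0" using e by (rule eventually_mono) (simp add: k1_def)
    show "\<forall>\<^sub>F w in nhds z. k2 w = 0" using e by (rule eventually_mono) (simp add: k2_def)
  qed

  have der1: "((\<lambda>\<tau>. k1 (dil 1 (1 + real \<gamma>) \<tau> z)) has_real_derivative d1 z) (at 0)" for z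
  proof (cases "z \<in> ?S")
    case True
    have "((\<lambda>\<tau>. gauge \<gamma> (dil 1 (1 + real \<gamma>) \<tau> z)) has_real_derivative gauge \<gamma> z) (at 0)"
      unfolding gauge_dil by (auto intro!: derivative_eq_intros)
    from flow[OF ball(5)[OF True] this refl] show ?thesis
      unfolding k1_def d1_def by (rule DERIV_cong) (simp add: power2_eq_square algebra_simps)
  next
    case False
    then show ?thesis using flow_derivative_vanish[OF ev(1)] zero(3) by metis
  qed
  have der2: "((\<lambda>\<tau>. k2 (dil 1 0 \<tau> z)) has_real_derivative d2 z) (at 0)" if "fst z \<noteq> 0" for z
  proof (cases "z \<in> ?S")
    case True
    from flow'[OF ball(5)[OF True] gauge_deriv_fst[OF that] refl] show ?thesis
      unfolding k2_def d2_def by (rule DERIV_cong) (simp add: power2_eq_square algebra_simps del: power_Suc)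
  next
    case False
    then show ?thesis using flow_derivative_vanish[OF ev(2)] zero(4) by metis
  qed

  \<comment> \<open>These are the integrability conditions for the two weights. The strongest one at
    the origin is that of \<open>w'\<close>, and it is the assumption Q + \<alpha> - 2 > 0.\<close>
  have "?Q + \<alpha> > 0" "?Q + (\<alpha> - 2) > 0" using Q by auto
  moreover have "real CARD('m) + real \<gamma> * (t + 2) > 0" using t by (simp add: algebra_simps add_pos_nonneg)
  ultimately have P: "?Q + \<alpha> > 0" "real CARD('m) + ?\<eta> > 0" "r > 0"
    and P': "?Q + (\<alpha> - 2) > 0" "real CARD('m) + real \<gamma> * (t + 2) > 0" "r > 0"
    using t r by auto
  show iG: "integrable lborel (\<lambda>z. w z * G z)"
    unfolding w_def by (rule integrable_wt_bounded[OF P _ bG]) (use out in auto)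
  show i2: "integrable lborel (\<lambda>z. w' z * (\<phi> z)\<^sup>2)"
    unfolding w'_def by (rule integrable_wt_bounded[OF P']) (use out in \<open>auto intro!: bounded_fun_on_intros b\<phi>\<close>)
  show i3: "integrable lborel (\<lambda>z. w z * (\<phi> z)\<^sup>2)"
    unfolding w_def by (rule integrable_wt_bounded[OF P]) (use out in \<open>auto intro!: bounded_fun_on_intros b\<phi>\<close>)
  \<comment> \<open>The weight \<open>w'\<close> has degree \<alpha> - 2, so the constant appearing
    here is 2 c.\<close>
  have I1: "integrable lborel (\<lambda>z. w' z * ((\<alpha> - 2 + ?Q) * k1 z + d1 z))"
      "(\<integral>z. w' z * ((\<alpha> - 2 + ?Q) * k1 z + d1 z) \<partial>lborel) = 0"
    unfolding w'_def
    by (rule integrable_wt_dil[OF P' m(1) b(1) zero(1) m(3) b(3) zero(3) der1]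
        integral_wt_dil[OF P' m(1) b(1) zero(1) m(3) b(3) zero(3) der1]; assumption)+
  have I2: "integrable lborel (\<lambda>z. w z * ((\<alpha> * \<theta> \<gamma> z + ?\<eta> * (1 - \<theta> \<gamma> z) + ?m) * k2 z + d2 z))"
      "(\<integral>z. w z * ((\<alpha> * \<theta> \<gamma> z + ?\<eta> * (1 - \<theta> \<gamma> z) + ?m) * k2 z + d2 z) \<partial>lborel) = 0"
    unfolding w_def
    by (rule integrable_wt_fst[OF P m(2) b(2) zero(2) m(4) b(4) zero(4) der2]
        integral_wt_fst[OF P m(2) b(2) zero(2) m(4) b(4) zero(4) der2]; assumption)+
  let ?\<Lambda> = "(?m + ?\<eta>) / ((B + 1) * r\<^sup>2)"

  \<comment> \<open>The inequality holds pointwise up to the two flow divergences, whose integrals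
    vanish by \<open>I1\<close> and \<open>I2\<close>.\<close>
  have pointwise: "w z * G z \<ge> c\<^sup>2 * (w' z * (\<phi> z)\<^sup>2) + ?\<Lambda> * (w z * (\<phi> z)\<^sup>2)
      + w' z * ((\<alpha> - 2 + ?Q) * k1 z + d1 z)
      + w z * ((\<alpha> * \<theta> \<gamma> z + ?\<eta> * (1 - \<theta> \<gamma> z) + ?m) * k2 z + d2 z)" if x: "fst z \<noteq> 0" for z
  proof (cases "z \<in> ?S")
    case False
    then show ?thesis using zero out by simp
  next
    case True
    define s \<rho> where "s = norm (fst z)" and "\<rho> = gauge \<gamma> z"
    have s: "s > 0" and \<rho>: "\<rho> > 0" using x gauge_pos[OF x, of \<gamma>] by (auto simp: s_def \<rho>_def)
    define \<psi> where "\<psi> = (s / \<rho>) ^ (2 * \<gamma>)"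
    define i where "i = 1 / \<rho>\<^sup>2"
    define th where "th = \<theta> \<gamma> z"
    have \<psi>: "\<psi> > 0" using s \<rho> by (simp add: \<psi>_def)
    have ir: "i * \<rho>\<^sup>2 = 1" using \<rho> by (simp add: i_def)
    have th: "th = \<psi> * s\<^sup>2 * i"
      unfolding th_def \<theta>_def \<psi>_def i_def s_def[symmetric] \<rho>_def[symmetric] by (simp add: power_add power_divide power2_eq_square mult_ac)
    have th\<psi>: "th \<le> \<psi>"
    proof -
      have "s\<^sup>2 \<le> \<rho>\<^sup>2" using norm_fst_le_gauge[of z \<gamma>] s by (intro power_mono) (auto simp: s_def \<rho>_def)
      then have "s\<^sup>2 * i \<le> 1" using \<rho> by (simp add: i_def)
      then show ?thesis unfolding th using \<psi> by (simp add: mult.assoc mult_le_cancel_left1)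
    qed
    \<comment> \<open>The ratio of the weights is the squared length of the Grushin gradient of log
      \<rho>. It serves both the Hardy term and the coefficient of the first flow.\<close>
    have w': "w' z = w z * (\<psi> * i)"
    proof -
      have "(s / \<rho>) powr (real \<gamma> * (t + 2)) = (s / \<rho>) powr ?\<eta> * (s / \<rho>) powr real (2 * \<gamma>)"
        by (simp add: powr_add[symmetric] algebra_simps)
      also have "(s / \<rho>) powr real (2 * \<gamma>) = \<psi>"
        unfolding \<psi>_def using s \<rho> by (intro powr_realpow) simp
      finally have "(s / \<rho>) powr (real \<gamma> * (t + 2)) = (s / \<rho>) powr ?\<eta> * \<psi>" .
      moreover have "\<rho> powr (\<alpha> - 2) = \<rho> powr \<alpha> * i"
        using \<rho> by (simp add: powr_diff i_def powr_numeral)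
      ultimately show ?thesis by (simp add: w_def w'_def wt_def s_def[symmetric] \<rho>_def[symmetric])
    qed
    have w0: "w z \<ge> 0" unfolding w_def by (rule wt_nonneg)
    have cQ: "2 * c = ?m + (1 + real \<gamma>) * real CARD('k) + \<alpha> - 2" by (simp add: c_def hom_dim_def)
    have Kz: "K z = c + 2 * B * \<rho>\<^sup>2 * v z" by (simp add: K_def \<rho>_def)
    have fp: "(norm (grad_fst \<phi> z))\<^sup>2 \<ge> 2 * (- \<phi> z * (K z * i * \<psi> + 2 * v z)) * X z
        - (- \<phi> z * (K z * i * \<psi> + 2 * v z))\<^sup>2 * s\<^sup>2"
      unfolding X_def s_def by (rule young_inner)
    \<comment> \<open>Dividing the coefficient by the weight e = |x|^(2 \<gamma>) removes e from the
      mixed term and leaves 1 / e in the quadratic one. The defining equation of \<rho> then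
      replaces |y|^2 by powers of \<rho> and |x|.\<close>
    have sq: "s ^ (2 * \<gamma>) * (norm (grad_snd \<phi> z))\<^sup>2 \<ge> 2 * (- \<phi> z * (K z * i * (1 + real \<gamma>) * \<psi>)) * Y z
        - \<phi> z ^ 2 * ((K z * i)\<^sup>2 * \<psi> * (\<rho>\<^sup>2 - \<psi> * s\<^sup>2))"
    proof -
      define e where "e = s ^ (2 * \<gamma>)"
      have e: "e > 0" using s by (simp add: e_def)
      define a where "a = - \<phi> z * (K z * i * (1 + real \<gamma>) * \<psi>)"
      have "(norm (grad_snd \<phi> z))\<^sup>2 \<ge> 2 * (a / e) * Y z - (a / e)\<^sup>2 * (norm (snd z))\<^sup>2"
        unfolding Y_def by (rule young_inner)
      then have "e * (norm (grad_snd \<phi> z))\<^sup>2 \<ge> e * (2 * (a / e) * Y z - (a / e)\<^sup>2 * (norm (snd z))\<^sup>2)"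
        using e by (intro mult_left_mono) auto
      also have "e * (2 * (a / e) * Y z - (a / e)\<^sup>2 * (norm (snd z))\<^sup>2) = 2 * a * Y z - a\<^sup>2 * (norm (snd z))\<^sup>2 / e"
        using e by (simp add: field_simps power2_eq_square)
      also have "a\<^sup>2 * (norm (snd z))\<^sup>2 / e = \<phi> z ^ 2 * ((K z * i)\<^sup>2 * \<psi> * (\<psi> * ((1 + real \<gamma>)\<^sup>2 * (norm (snd z))\<^sup>2) / e))"
        by (simp add: a_def power_mult_distrib power2_eq_square)
      also have "(1 + real \<gamma>)\<^sup>2 * (norm (snd z))\<^sup>2 = \<rho> ^ (2 * (1 + \<gamma>)) - s ^ (2 * (1 + \<gamma>))"
        unfolding \<rho>_def s_def gauge_pow by simp
      also have "\<psi> * (\<rho> ^ (2 * (1 + \<gamma>)) - s ^ (2 * (1 + \<gamma>))) / e = \<rho>\<^sup>2 - \<psi> * s\<^sup>2"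
      proof -
        have "\<psi> * \<rho> ^ (2 * (1 + \<gamma>)) = e * \<rho>\<^sup>2"
          using \<rho> by (simp add: \<psi>_def e_def power_divide power_add power2_eq_square)
        moreover have "s ^ (2 * (1 + \<gamma>)) = e * s\<^sup>2" by (simp add: e_def power_add power2_eq_square)
        ultimately have "\<psi> * (\<rho> ^ (2 * (1 + \<gamma>)) - s ^ (2 * (1 + \<gamma>))) = e * (\<rho>\<^sup>2 - \<psi> * s\<^sup>2)"
          by (simp only: right_diff_distrib mult.left_commute)
        then show ?thesis using e by simp
      qed
      finally show ?thesis unfolding e_def a_def .
    qed
    have "G z \<ge> 2 * \<phi> z * (- (K z * i * \<psi> + 2 * v z) * X z - K z * i * (1 + real \<gamma>) * \<psi> * Y z)
      - (\<phi> z)\<^sup>2 * ((K z * i * \<psi> + 2 * v z)\<^sup>2 * s\<^sup>2 + (K z * i)\<^sup>2 * \<psi> * (\<rho>\<^sup>2 - \<psi> * s\<^sup>2))" (is "_ \<ge> ?L")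
    proof -
      have "G z = (norm (grad_fst \<phi> z))\<^sup>2 + s ^ (2 * \<gamma>) * (norm (grad_snd \<phi> z))\<^sup>2"
        by (simp add: G_def s_def)
      moreover have "?L = (2 * (- \<phi> z * (K z * i * \<psi> + 2 * v z)) * X z
          - (- \<phi> z * (K z * i * \<psi> + 2 * v z))\<^sup>2 * s\<^sup>2)
        + (2 * (- \<phi> z * (K z * i * (1 + real \<gamma>) * \<psi>)) * Y z
          - \<phi> z ^ 2 * ((K z * i)\<^sup>2 * \<psi> * (\<rho>\<^sup>2 - \<psi> * s\<^sup>2)))"
        by (simp add: power2_eq_square algebra_simps)
      ultimately show ?thesis using fp sq by linarith
    qed
    \<comment> \<open>The lower bound splits into the Hardy term, the gain with factor v and the two
      flow divergences.\<close>
    also note supersolution_identity[OF ir th Kz cQ, where \<phi> = "\<phi> z" and X = "X z" and Y = "Y z" and t = t]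
    finally have main: "G z \<ge> (\<phi> z)\<^sup>2 * (c\<^sup>2 * \<psi> * i + v z * (4 * B * \<psi> + 2 * (?m + t * real \<gamma>)
          - 2 * (?m + (1 + real \<gamma>) * real CARD('k) - 2 + t * real \<gamma>) * th))
        + \<psi> * i * ((\<alpha> - 2 + ?Q) * k1 z + d1 z)
        + ((\<alpha> * th + ?\<eta> * (1 - th) + ?m) * k2 z + d2 z)"
    proof -
      have c2: "\<alpha> - 2 + ?Q = 2 * c" by (simp add: c_def)
      show "?thesis" if "(\<phi> z)\<^sup>2 * (c\<^sup>2 * \<psi> * i + v z * (4 * B * \<psi> + 2 * (?m + t * real \<gamma>)
          - 2 * (?m + (1 + real \<gamma>) * real CARD('k) - 2 + t * real \<gamma>) * th))
        + \<psi> * i * (2 * c * - (K z * (\<phi> z)\<^sup>2) - ((4 * B * \<rho>\<^sup>2 * v z + 4 * B * \<rho>\<^sup>2 * (B * \<rho>\<^sup>2 + s\<^sup>2) * (v z)\<^sup>2) * (\<phi> z)\<^sup>2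
            + 2 * K z * \<phi> z * (X z + (1 + real \<gamma>) * Y z)))
        + ((\<alpha> * th + real \<gamma> * t * (1 - th) + ?m) * (- 2 * v z * (\<phi> z)\<^sup>2)
          - 2 * ((2 * B * th * \<rho>\<^sup>2 + 2 * s\<^sup>2) * (v z)\<^sup>2 * (\<phi> z)\<^sup>2 + 2 * v z * \<phi> z * X z)) \<le> G z"
        using that unfolding c2 k1_def d1_def k2_def d2_def th_def[symmetric] s_def[symmetric] \<rho>_def[symmetric]
        by (simp only: mult_minus_left diff_conv_add_uminus)
    qed
    have v0: "v z > 0" using ball(5)[OF True] by (simp add: v_def)
    \<comment> \<open>The upper bound 2 (B + 1) r^2 for u yields the rate 1 / r^2.\<close>
    have vl: "v z * (2 * (?m + t * real \<gamma>)) \<ge> ?\<Lambda>"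
    proof -
      have "v z \<ge> 1 / (2 * (B + 1) * r\<^sup>2)"
        unfolding v_def using ball(4,5)[OF True] B r by (intro divide_left_mono mult_pos_pos) auto
      then have "v z * (2 * (?m + t * real \<gamma>)) \<ge> 1 / (2 * (B + 1) * r\<^sup>2) * (2 * (?m + t * real \<gamma>))"
        using t by (intro mult_right_mono) (auto simp: mult.commute)
      also have "1 / (2 * (B + 1) * r\<^sup>2) * (2 * (?m + t * real \<gamma>)) = ?\<Lambda>"
      proof -
        have "1 / (2 * (B + 1) * r\<^sup>2) * (2 * (?m + t * real \<gamma>)) = (2 * (?m + ?\<eta>)) / (2 * ((B + 1) * r\<^sup>2))"
          by (simp only: mult.assoc mult.commute[of t] times_divide_eq_left mult_1_left)
        also have "\<dots> = ?\<Lambda>" by (rule mult_divide_mult_cancel_left) simp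
        finally show ?thesis .
      qed
      finally show ?thesis .
    qed
    \<comment> \<open>Here B is used: the error (Q - 2 + t \<gamma>) \<theta> is at most 2 B
      \<theta>, and \<theta> \<le> \<psi> because |x| \<le> \<rho>.\<close>
    have "2 * (?m + (1 + real \<gamma>) * real CARD('k) - 2 + t * real \<gamma>) * th \<le> 4 * B * \<psi>"
    proof -
      have "th \<ge> 0" unfolding th_def by (rule theta_nonneg)
      have "(?m + (1 + real \<gamma>) * real CARD('k) - 2 + t * real \<gamma>) * th \<le> 2 * B * th"
        using \<open>th \<ge> 0\<close> by (intro mult_right_mono) (auto simp: B_def hom_dim_def)
      also have "\<dots> \<le> 2 * B * \<psi>" using th\<psi> B by (intro mult_left_mono) auto
      finally show ?thesis unfolding mult.assoc[of 2] by linarith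
    qed
    then have "v z * (4 * B * \<psi> + 2 * (?m + t * real \<gamma>)
          - 2 * (?m + (1 + real \<gamma>) * real CARD('k) - 2 + t * real \<gamma>) * th) \<ge> v z * (2 * (?m + t * real \<gamma>))"
      using v0 by (intro mult_left_mono) auto
    with vl have "(\<phi> z)\<^sup>2 * (c\<^sup>2 * \<psi> * i + ?\<Lambda>) \<le> (\<phi> z)\<^sup>2 * (c\<^sup>2 * \<psi> * i + v z * (4 * B * \<psi> + 2 * (?m + t * real \<gamma>)
          - 2 * (?m + (1 + real \<gamma>) * real CARD('k) - 2 + t * real \<gamma>) * th))"
      by (intro mult_left_mono) auto
    with main have "G z \<ge> (\<phi> z)\<^sup>2 * (c\<^sup>2 * \<psi> * i + ?\<Lambda>) + \<psi> * i * ((\<alpha> - 2 + ?Q) * k1 z + d1 z)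
        + ((\<alpha> * th + ?\<eta> * (1 - th) + ?m) * k2 z + d2 z)" (is "_ \<ge> ?L")
      by linarith
    then have "w z * G z \<ge> w z * ?L" using w0 by (rule mult_left_mono)
    also have "w z * ?L = c\<^sup>2 * (w' z * (\<phi> z)\<^sup>2) + ?\<Lambda> * (w z * (\<phi> z)\<^sup>2)
      + w' z * ((\<alpha> - 2 + ?Q) * k1 z + d1 z) + w z * ((\<alpha> * th + ?\<eta> * (1 - th) + ?m) * k2 z + d2 z)"
      unfolding w' by (simp only: distrib_left mult_ac)
    finally show ?thesis unfolding th_def .
  qed
  have lin: "(\<integral>z. a * f1 z + b * f2 z + f3 z + f4 z \<partial>lborel)
      = a * (\<integral>z. f1 z \<partial>lborel) + b * (\<integral>z. f2 z \<partial>lborel) + (\<integral>z. f3 z \<partial>lborel) + (\<integral>z. f4 z \<partial>lborel)"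
    if "integrable lborel f1" "integrable lborel f2" "integrable lborel f3" "integrable lborel f4"
    for a b and f1 f2 f3 f4 :: "(real^'m) \<times> (real^'k) \<Rightarrow> real"
    using that by simp
  have "(\<integral>z. c\<^sup>2 * (w' z * (\<phi> z)\<^sup>2) + ?\<Lambda> * (w z * (\<phi> z)\<^sup>2)
      + w' z * ((\<alpha> - 2 + ?Q) * k1 z + d1 z)
      + w z * ((\<alpha> * \<theta> \<gamma> z + ?\<eta> * (1 - \<theta> \<gamma> z) + ?m) * k2 z + d2 z) \<partial>lborel) \<le> (\<integral>z. w z * G z \<partial>lborel)"
  proof (rule integral_mono_AE)
    show "AE z in lborel. c\<^sup>2 * (w' z * (\<phi> z)\<^sup>2) + ?\<Lambda> * (w z * (\<phi> z)\<^sup>2)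
      + w' z * ((\<alpha> - 2 + ?Q) * k1 z + d1 z)
      + w z * ((\<alpha> * \<theta> \<gamma> z + ?\<eta> * (1 - \<theta> \<gamma> z) + ?m) * k2 z + d2 z) \<le> w z * G z"
      using AE_fst_nonzero by eventually_elim (rule pointwise)
    show "integrable lborel (\<lambda>z. w z * G z)" by (rule iG)
  qed (intro Bochner_Integration.integrable_add integrable_mult_right i2 i3 I1 I2)
  also have "(\<integral>z. c\<^sup>2 * (w' z * (\<phi> z)\<^sup>2) + ?\<Lambda> * (w z * (\<phi> z)\<^sup>2)
      + w' z * ((\<alpha> - 2 + ?Q) * k1 z + d1 z)
      + w z * ((\<alpha> * \<theta> \<gamma> z + ?\<eta> * (1 - \<theta> \<gamma> z) + ?m) * k2 z + d2 z) \<partial>lborel)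
      = c\<^sup>2 * (\<integral>z. w' z * (\<phi> z)\<^sup>2 \<partial>lborel) + ?\<Lambda> * (\<integral>z. w z * (\<phi> z)\<^sup>2 \<partial>lborel) + 0 + 0"
    by (rule trans[OF lin[OF i2 i3 I1(1) I2(1)]]) (simp only: I1(2) I2(2))
  finally show "(\<integral>z. w z * G z \<partial>lborel) \<ge> c\<^sup>2 * (\<integral>z. w' z * (\<phi> z)\<^sup>2 \<partial>lborel)
      + ?\<Lambda> * (\<integral>z. w z * (\<phi> z)\<^sup>2 \<partial>lborel)"
    by simp
qed

section \<open>Transfer to the extended nonnegative integrals of the theorem\<close>

lemma gauge_weight_eq_wt:
  assumes "fst z \<noteq> 0"
  shows "gauge \<gamma> z powr \<beta> * grushin_grad_norm \<gamma> (gauge \<gamma>) z powr t = wt \<gamma> \<beta> (real \<gamma> * t) z"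
proof -
  have "norm (fst z) / gauge \<gamma> z > 0" using assms gauge_pos[OF assms, of \<gamma>] by simp
  then show ?thesis
    by (simp add: grushin_grad_norm_gauge[OF assms] wt_def powr_realpow[symmetric] powr_powr)
qed

theorem theorem3p1:
  fixes \<gamma> :: nat and \<alpha> t :: real
  assumes "\<gamma> > 0" and "even \<gamma>"
    and "- real CARD('m) / real \<gamma> < t" and "t < real CARD('m) / real \<gamma>"
    and "hom_dim CARD('m) CARD('k) \<gamma> + \<alpha> - 2 > 0"
  shows "\<exists>C>0. \<forall>r>0. \<forall>\<phi> :: (real^'m::finite) \<times> (real^'k::finite) \<Rightarrow> real.
    test_fun (gauge_ball \<gamma> r) \<phi> \<longrightarrow>
      (\<integral>\<^sup>+ z \<in> gauge_ball \<gamma> r.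
          ennreal (gauge \<gamma> z powr \<alpha> * grushin_grad_norm \<gamma> (gauge \<gamma>) z powr t
                   * (grushin_grad_norm \<gamma> \<phi> z)\<^sup>2) \<partial>lborel)
      \<ge> ennreal (((hom_dim CARD('m) CARD('k) \<gamma> + \<alpha> - 2) / 2)\<^sup>2) *
          (\<integral>\<^sup>+ z \<in> gauge_ball \<gamma> r.
             ennreal (gauge \<gamma> z powr \<alpha> * grushin_grad_norm \<gamma> (gauge \<gamma>) z powr (t + 2)
                      / (gauge \<gamma> z)\<^sup>2 * (\<phi> z)\<^sup>2) \<partial>lborel)
        + ennreal (1 / (C\<^sup>2 * r\<^sup>2)) *
          (\<integral>\<^sup>+ z \<in> gauge_ball \<gamma> r.
             ennreal (gauge \<gamma> z powr \<alpha> * grushin_grad_norm \<gamma> (gauge \<gamma>) z powr t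
                      * (\<phi> z)\<^sup>2) \<partial>lborel)"
proof -
  let ?Q = "hom_dim CARD('m) CARD('k) \<gamma>" and ?m = "real CARD('m)"
  define B where "B = \<bar>?Q - 2 + t * real \<gamma>\<bar> / 2"
  \<comment> \<open>Chosen so that 1 / C^2 is the gain (m + \<gamma> t) / (B + 1). It depends on
    neither \<phi> nor r, and the lower bound on t makes it positive.\<close>
  define C where "C = sqrt ((B + 1) / (?m + real \<gamma> * t))"
  have t: "?m + real \<gamma> * t > 0" using assms(1,3) by (simp add: field_simps)
  have B: "B \<ge> 0" by (simp add: B_def)
  have C0: "C > 0" unfolding C_def using B t by simp
  have C2: "C\<^sup>2 = (B + 1) / (?m + real \<gamma> * t)" unfolding C_def using B t by simp
  show ?thesis
  proof (intro exI[of _ C] conjI C0 allI impI)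
    fix r :: real and \<phi> :: "(real^'m) \<times> (real^'k) \<Rightarrow> real"
    assume r: "r > 0" and \<phi>: "test_fun (gauge_ball \<gamma> r) \<phi>"
    define G where "G = (\<lambda>z. (norm (grad_fst \<phi> z))\<^sup>2 + norm (fst z) ^ (2 * \<gamma>) * (norm (grad_snd \<phi> z))\<^sup>2)"
    define w where "w = (wt \<gamma> \<alpha> (real \<gamma> * t) :: (real^'m) \<times> (real^'k) \<Rightarrow> real)"
    define w' where "w' = (wt \<gamma> (\<alpha> - 2) (real \<gamma> * (t + 2)) :: (real^'m) \<times> (real^'k) \<Rightarrow> real)"
    have H: "integrable lborel (\<lambda>z. w z * G z)"
      "integrable lborel (\<lambda>z. w' z * (\<phi> z)\<^sup>2)" "integrable lborel (\<lambda>z. w z * (\<phi> z)\<^sup>2)"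
      "((?Q + \<alpha> - 2) / 2)\<^sup>2 * (\<integral>z. w' z * (\<phi> z)\<^sup>2 \<partial>lborel)
        + (?m + real \<gamma> * t) / ((B + 1) * r\<^sup>2) * (\<integral>z. w z * (\<phi> z)\<^sup>2 \<partial>lborel) \<le> (\<integral>z. w z * G z \<partial>lborel)"
      unfolding G_def w_def w'_def B_def by (rule grushin_hardy_integral[OF r \<phi> t assms(5)])+
    have out: "\<phi> z = 0" "G z = 0" if "z \<notin> gauge_ball \<gamma> r" for z
    proof -
      have z: "z \<notin> closure {z. \<phi> z \<noteq> 0}" using that \<phi> by (auto simp: test_fun_def)
      show "\<phi> z = 0" by (rule test_fun_vanish(1)[OF \<phi> z])
      show "G z = 0" by (simp only: G_def test_fun_vanish(2,3)[OF \<phi> z]) simp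
    qed
    have w0: "w z \<ge> 0" "w' z \<ge> 0" "G z \<ge> 0" for z
      by (simp_all add: w_def w'_def G_def wt_nonneg)
    \<comment> \<open>The integrands of the theorem are identified with those built from
      \<open>wt\<close> only where x \<noteq> 0, which suffices up to a null set. The restriction to
      the ball disappears because g vanishes outside it.\<close>
    have conv: "(\<integral>\<^sup>+ z \<in> gauge_ball \<gamma> r. ennreal (f z) \<partial>lborel) = ennreal (\<integral>z. g z \<partial>lborel)"
      if "integrable lborel g" "\<And>z. g z \<ge> 0" "\<And>z. fst z \<noteq> 0 \<Longrightarrow> f z = g z"
        "\<And>z. z \<notin> gauge_ball \<gamma> r \<Longrightarrow> g z = 0"
      for f g :: "(real^'m) \<times> (real^'k) \<Rightarrow> real"
    proof -
      have "AE z in lborel. ennreal (f z) * indicator (gauge_ball \<gamma> r) z = ennreal (g z)"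
        using AE_fst_nonzero by eventually_elim (use that(3,4) in \<open>auto simp: indicator_def\<close>)
      then have "(\<integral>\<^sup>+ z \<in> gauge_ball \<gamma> r. ennreal (f z) \<partial>lborel) = (\<integral>\<^sup>+ z. ennreal (g z) \<partial>lborel)"
        by (rule nn_integral_cong_AE)
      also have "\<dots> = ennreal (\<integral>z. g z \<partial>lborel)"
        using that(1,2) by (intro nn_integral_eq_integral) auto
      finally show ?thesis .
    qed
    have L: "(\<integral>\<^sup>+ z \<in> gauge_ball \<gamma> r. ennreal (gauge \<gamma> z powr \<alpha> * grushin_grad_norm \<gamma> (gauge \<gamma>) z powr t
        * (grushin_grad_norm \<gamma> \<phi> z)\<^sup>2) \<partial>lborel) = ennreal (\<integral>z. w z * G z \<partial>lborel)"
    proof (rule conv[OF H(1)])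
      fix z :: "(real^'m) \<times> (real^'k)" assume z: "fst z \<noteq> 0"
      have "(grushin_grad_norm \<gamma> \<phi> z)\<^sup>2 = G z"
        unfolding grushin_grad_norm_eq G_def by simp
      then show "gauge \<gamma> z powr \<alpha> * grushin_grad_norm \<gamma> (gauge \<gamma>) z powr t
        * (grushin_grad_norm \<gamma> \<phi> z)\<^sup>2 = w z * G z"
        unfolding gauge_weight_eq_wt[OF z] w_def by simp
    qed (use w0 out(2) in auto)
    have R1: "(\<integral>\<^sup>+ z \<in> gauge_ball \<gamma> r. ennreal (gauge \<gamma> z powr \<alpha> * grushin_grad_norm \<gamma> (gauge \<gamma>) z powr (t + 2)
        / (gauge \<gamma> z)\<^sup>2 * (\<phi> z)\<^sup>2) \<partial>lborel) = ennreal (\<integral>z. w' z * (\<phi> z)\<^sup>2 \<partial>lborel)"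
    proof (rule conv[OF H(2)])
      fix z :: "(real^'m) \<times> (real^'k)" assume z: "fst z \<noteq> 0"
      have e: "gauge \<gamma> z powr (\<alpha> - 2) = gauge \<gamma> z powr \<alpha> / (gauge \<gamma> z)\<^sup>2"
        using gauge_pos[OF z, of \<gamma>] by (simp add: powr_diff powr_numeral)
      then show "gauge \<gamma> z powr \<alpha> * grushin_grad_norm \<gamma> (gauge \<gamma>) z powr (t + 2)
        / (gauge \<gamma> z)\<^sup>2 * (\<phi> z)\<^sup>2 = w' z * (\<phi> z)\<^sup>2"
        unfolding w'_def gauge_weight_eq_wt[OF z, symmetric] e by simp
    qed (use w0 out(1) in auto)
    have R2: "(\<integral>\<^sup>+ z \<in> gauge_ball \<gamma> r. ennreal (gauge \<gamma> z powr \<alpha> * grushin_grad_norm \<gamma> (gauge \<gamma>) z powr t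
        * (\<phi> z)\<^sup>2) \<partial>lborel) = ennreal (\<integral>z. w z * (\<phi> z)\<^sup>2 \<partial>lborel)"
      by (rule conv[OF H(3)]) (use w0 out(1) in \<open>auto simp: gauge_weight_eq_wt w_def\<close>)
    have "1 / (C\<^sup>2 * r\<^sup>2) = (?m + real \<gamma> * t) / ((B + 1) * r\<^sup>2)"
      unfolding C2 by simp
    with H(4) have "((?Q + \<alpha> - 2) / 2)\<^sup>2 * (\<integral>z. w' z * (\<phi> z)\<^sup>2 \<partial>lborel)
        + 1 / (C\<^sup>2 * r\<^sup>2) * (\<integral>z. w z * (\<phi> z)\<^sup>2 \<partial>lborel) \<le> (\<integral>z. w z * G z \<partial>lborel)"
      by (simp only:)
    then have "ennreal (((?Q + \<alpha> - 2) / 2)\<^sup>2 * (\<integral>z. w' z * (\<phi> z)\<^sup>2 \<partial>lborel)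
        + 1 / (C\<^sup>2 * r\<^sup>2) * (\<integral>z. w z * (\<phi> z)\<^sup>2 \<partial>lborel)) \<le> ennreal (\<integral>z. w z * G z \<partial>lborel)"
      by (rule ennreal_leI)
    moreover have "(\<integral>z. w' z * (\<phi> z)\<^sup>2 \<partial>lborel) \<ge> 0" "(\<integral>z. w z * (\<phi> z)\<^sup>2 \<partial>lborel) \<ge> 0"
      using w0 by (auto intro!: integral_nonneg_AE)
    moreover have comb: "ennreal p * ennreal I + ennreal q * ennreal J = ennreal (p * I + q * J)"
      if "p \<ge> 0" "q \<ge> 0" "I \<ge> 0" "J \<ge> 0" for p q I J :: real
      using that by (simp add: ennreal_mult)
    ultimately show "ennreal (((?Q + \<alpha> - 2) / 2)\<^sup>2) *
          (\<integral>\<^sup>+ z \<in> gauge_ball \<gamma> r.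
             ennreal (gauge \<gamma> z powr \<alpha> * grushin_grad_norm \<gamma> (gauge \<gamma>) z powr (t + 2)
                      / (gauge \<gamma> z)\<^sup>2 * (\<phi> z)\<^sup>2) \<partial>lborel)
        + ennreal (1 / (C\<^sup>2 * r\<^sup>2)) *
          (\<integral>\<^sup>+ z \<in> gauge_ball \<gamma> r.
             ennreal (gauge \<gamma> z powr \<alpha> * grushin_grad_norm \<gamma> (gauge \<gamma>) z powr t
                      * (\<phi> z)\<^sup>2) \<partial>lborel)
        \<le> (\<integral>\<^sup>+ z \<in> gauge_ball \<gamma> r.
          ennreal (gauge \<gamma> z powr \<alpha> * grushin_grad_norm \<gamma> (gauge \<gamma>) z powr t
                   * (grushin_grad_norm \<gamma> \<phi> z)\<^sup>2) \<partial>lborel)"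
      unfolding L R1 R2 by (subst comb) simp_all
  qed
qed

end
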